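(* Let $\delta=1$, and let $(f^\varepsilon,A^\Lambda)$ be the unique solution to $$\partial_tf+\widehat v\cdot\nabla_xf+\langle v\rangle\,\partial_{x^1}A\,\partial_{v^1}f=0,\qquad \Box A=\int_{\mathbb{R}^3_v}f\,\mathrm{d}v$$ with initial data $A^\Lambda(0,x)=\Lambda\,\mathcal{A}(-|x|)/|x|$, $\partial_tA^\Lambda(0,x)=\Lambda\,\mathcal{A}'(-|x|)/|x|$ and $f^\varepsilon(0,\cdot,\cdot)=\varepsilon f_0$, where $f_0\in C^\infty(\mathbb{R}^3_x\times\mathbb{R}^3_v,\mathbb{R}_+)$ satisfies $\|f_0\|_{L^1_{x,v}}=1$ and $$f_0(x,v)\neq0\quad\Longrightarrow\quad |x-(7,0,0)|\le1,\quad 0\le v^2,v^3\le1\le v^1,$$ where $v=(v^1,v^2,v^3)$. There exists $\Lambda_0>0$ such that, if $\Lambda\ge\Lambda_0$, the following holds. For all $C_{\mathrm{large}},\varepsilon_1>0$, there exists $0<\varepsilon\le\varepsilon_1$ such that - either $(f^\varepsilon,A^\Lambda)$ blows up in finite time, - or $\|f^\varepsilon(t,\cdot,\cdot)\|_{L^1_{x,v}}\ge\|f^\varepsilon(0,\cdot,\cdot)\|_{L^1_{x,v}}(1+t)^{c\Lambda}$ (for all $t\ge0$), where $c>0$ is an absolute constant, - or there exists $(T,x)\in\mathbb{R}_+\times\mathbb{R}^3$ such that $\langle T\rangle\,\big|\partial_{x^1}A^\Lambda-\Lambda\,\partial_{x^1}\mathcal{A}_{\mathrm{hom}}\big|(T,x)\ge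 C_{\mathrm{large}}\,\varepsilon$.
   Context: Notation: $\langle z\rangle=\sqrt{1+|z|^2}$, $\widehat v=v/\langle v\rangle$, $\Box=-\partial_t^2+\Delta_x$; superscripts on $x,v$ denote components. $\mathcal{A}\in C^3_c(\mathbb{R},\mathbb{R}_+)$ is a fixed function such that $\mathcal{A}(u)=e^{-2u}$ for all $u\in[-10,-1]$ and $\mathcal{A}(u)=0$ for all $u\ge0$. $\mathcal{A}_{\mathrm{hom}}$ is the spherically symmetric solution of the homogeneous wave equation $\Box\mathcal{A}_{\mathrm{hom}}=0$ with $\mathcal{A}_{\mathrm{hom}}(0,x)=\mathcal{A}(-|x|)/|x|$ and $\partial_t\mathcal{A}_{\mathrm{hom}}(0,x)=\mathcal{A}'(-|x|)/|x|$, that is $\mathcal{A}_{\mathrm{hom}}(t,x)=\mathcal{A}(t-|x|)/|x|$ for $t\ge0$. "Absolute constant" means independent of $\Lambda,\varepsilon,f_0$ ($\mathcal{A}$ being fixed). *)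

theory Defs
  imports "HOL-Analysis.Analysis"
begin

type_synonym vec3 = "real ^ 3"

definition jbracket :: "'a::real_normed_vector \<Rightarrow> real" where
  "jbracket z = sqrt (1 + (norm z)\<^sup>2)"

definition vhat :: "vec3 \<Rightarrow> vec3" where
  "vhat v = v /\<^sub>R jbracket v"

text \<open>Derivatives are taken relative to a set, so that time derivatives are one-sided at
  the initial time. The sets used below are the whole space and \<open>slab T\<close> with \<open>T > 0\<close>; they are
  convex with nonempty interior, hence derivatives within them are unique.\<close>

definition pd :: "'a::euclidean_space set \<Rightarrow> 'a \<Rightarrow> ('a \<Rightarrow> real) \<Rightarrow> 'a \<Rightarrow> real" where
  "pd S b g z = frechet_derivative g (at z within S) b"

primrec Ck_on :: "nat \<Rightarrow> 'a::euclidean_space set \<Rightarrow> ('a \<Rightarrow> real) \<Rightarrow> bool" where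
  "Ck_on 0 S g \<longleftrightarrow> continuous_on S g"
| "Ck_on (Suc k) S g \<longleftrightarrow> g differentiable_on S \<and> (\<forall>b\<in>Basis. Ck_on k S (pd S b g))"

definition slab :: "ereal \<Rightarrow> (real \<times> 'a) set" where
  "slab T = {t. 0 \<le> t \<and> ereal t < T} \<times> UNIV"

definition box_op :: "(real \<times> vec3) set \<Rightarrow> (real \<times> vec3 \<Rightarrow> real) \<Rightarrow> real \<times> vec3 \<Rightarrow> real" where
  "box_op S A z =
     - pd S (1, 0) (pd S (1, 0) A) z
     + (\<Sum>i\<in>UNIV. pd S (0, axis i 1) (pd S (0, axis i 1) A) z)"

text \<open>Classical solutions on \<open>[0,T)\<close>, where \<open>T\<close> may be infinite. Only integrability of
  \<open>f(t,x,\<cdot>)\<close> is imposed in \<open>v\<close>, since the initial data need not have bounded velocity support.\<close>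

definition solution ::
  "ereal \<Rightarrow> (real \<times> vec3 \<times> vec3 \<Rightarrow> real) \<Rightarrow> (real \<times> vec3 \<Rightarrow> real) \<Rightarrow> bool" where
  "solution T f A \<longleftrightarrow>
     0 < T \<and> Ck_on 1 (slab T) f \<and> Ck_on 2 (slab T) A \<and>
     (\<forall>(t, x)\<in>slab T. integrable lborel (\<lambda>v. f (t, x, v))) \<and>
     (\<forall>(t, x, v)\<in>slab T.
        pd (slab T) (1, 0, 0) f (t, x, v)
        + (\<Sum>i\<in>UNIV. vhat v $ i * pd (slab T) (0, axis i 1, 0) f (t, x, v))
        + jbracket v * pd (slab T) (0, axis 1 1) A (t, x)
            * pd (slab T) (0, 0, axis 1 1) f (t, x, v) = 0) \<and>
     (\<forall>(t, x)\<in>slab T. box_op (slab T) A (t, x) = (\<integral>v. f (t, x, v) \<partial>lborel))"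

text \<open>The profiles below are singular only formally at \<open>x = 0\<close>: since the radial function vanishes
  on \<open>[0,\<infinity>)\<close> and is three times continuously differentiable, the continuous extension to \<open>x = 0\<close>
  has value \<open>0\<close>, in agreement with the convention \<open>a / 0 = 0\<close>.\<close>

definition has_data ::
  "(real \<Rightarrow> real) \<Rightarrow> real \<Rightarrow> real \<Rightarrow> (vec3 \<times> vec3 \<Rightarrow> real) \<Rightarrow> ereal \<Rightarrow>
   (real \<times> vec3 \<times> vec3 \<Rightarrow> real) \<Rightarrow> (real \<times> vec3 \<Rightarrow> real) \<Rightarrow> bool" where
  "has_data \<A> \<Lambda> \<epsilon> f0 T f A \<longleftrightarrow>
     (\<forall>x v. f (0, x, v) = \<epsilon> * f0 (x, v)) \<and>
     (\<forall>x. A (0, x) = \<Lambda> * \<A> (- norm x) / norm x) \<and>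
     (\<forall>x. pd (slab T) (1, 0) A (0, x) = \<Lambda> * deriv \<A> (- norm x) / norm x)"

text \<open>\<open>T\<close> is the maximal existence time; finite-time blow-up means \<open>T < \<infinity>\<close>.\<close>

definition maximal_solution ::
  "(real \<Rightarrow> real) \<Rightarrow> real \<Rightarrow> real \<Rightarrow> (vec3 \<times> vec3 \<Rightarrow> real) \<Rightarrow> ereal \<Rightarrow>
   (real \<times> vec3 \<times> vec3 \<Rightarrow> real) \<Rightarrow> (real \<times> vec3 \<Rightarrow> real) \<Rightarrow> bool" where
  "maximal_solution \<A> \<Lambda> \<epsilon> f0 T f A \<longleftrightarrow>
     solution T f A \<and> has_data \<A> \<Lambda> \<epsilon> f0 T f A \<and>
     \<not> (\<exists>T' f' A'. T < T' \<and> solution T' f' A' \<and>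
          (\<forall>z\<in>slab T. f' z = f z) \<and> (\<forall>z\<in>slab T. A' z = A z))"

definition A_hom :: "(real \<Rightarrow> real) \<Rightarrow> real \<times> vec3 \<Rightarrow> real" where
  "A_hom \<A> = (\<lambda>(t, x). \<A> (t - norm x) / norm x)"
    \<comment> \<open>the spherically symmetric free wave for \<open>t \<ge> 0\<close>, the only times at which it is used\<close>

definition L1_norm :: "(vec3 \<times> vec3 \<Rightarrow> real) \<Rightarrow> ennreal" where
  "L1_norm g = (\<integral>\<^sup>+ z. ennreal \<bar>g z\<bar> \<partial>lborel)"

definition radial_profile :: "(real \<Rightarrow> real) \<Rightarrow> bool" where
  "radial_profile \<A> \<longleftrightarrow>
     Ck_on 3 UNIV \<A> \<and> compact (closure {u. \<A> u \<noteq> 0}) \<and> (\<forall>u. 0 \<le> \<A> u) \<and>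
     (\<forall>u\<in>{-10..-1}. \<A> u = exp (- 2 * u)) \<and> (\<forall>u\<ge>0. \<A> u = 0)"

definition initial_density :: "(vec3 \<times> vec3 \<Rightarrow> real) \<Rightarrow> bool" where
  "initial_density f0 \<longleftrightarrow>
     (\<forall>k. Ck_on k UNIV f0) \<and> (\<forall>z. 0 \<le> f0 z) \<and> L1_norm f0 = 1 \<and>
     (\<forall>x v. f0 (x, v) \<noteq> 0 \<longrightarrow>
        norm (x - vector [7, 0, 0]) \<le> 1 \<and>
        0 \<le> v $ 2 \<and> v $ 2 \<le> 1 \<and> 0 \<le> v $ 3 \<and> v $ 3 \<le> 1 \<and> 1 \<le> v $ 1)"

end

theory Submission
  imports Defs
begin

text \<open>
  Suppose that the solution is global and that \<open>\<partial>\<^bsub>x\<^sup>1\<^esub> A\<close> stays closer than \<open>C \<epsilon> / \<langle>t\<rangle>\<close> to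
  \<open>\<Lambda> \<partial>\<^bsub>x\<^sup>1\<^esub> A\<^sub>h\<^sub>o\<^sub>m\<close>; with \<open>\<epsilon> \<le> 1/C\<close> the difference is at most \<open>1/\<langle>t\<rangle>\<close>. Near the ray
  \<open>x = (t + 7, 0, 0)\<close> the free wave has \<open>\<partial>\<^bsub>x\<^sup>1\<^esub> A\<^sub>h\<^sub>o\<^sub>m \<ge> 1 / (20 (1 + t))\<close>
  (\<open>pd_A_hom_lower_bound\<close>), so for large \<open>\<Lambda>\<close> the force \<open>F = \<partial>\<^bsub>x\<^sup>1\<^esub> A\<close> satisfies
  \<open>F \<ge> k / (1 + t)\<close> there, with \<open>k = \<Lambda> / 40\<close> (\<open>force_lower_bound\<close>). A particle of the initial support
  starts near that ray and is accelerated along it: \<open>v\<^sup>1\<close> grows at least like \<open>(1 + t)\<^bsup>k\<^esup>\<close>, its speed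
  approaches the speed of light at an integrable rate, and it never leaves the neighbourhood of the ray. The
  phase space flow has divergence \<open>(v\<^sup>1/\<langle>v\<rangle>) F \<ge> (k/5) / (1 + t)\<close> along such a trajectory, while \<open>f\<close>
  is constant along it. Hence the integral of \<open>f\<close> grows at least like \<open>(1 + t)\<^bsup>k/5\<^esup>\<close>.

  The flow is never constructed. Its support property is expressed by a cutoff function on space-time
  that does not decrease in the direction of the characteristics; it is made of six walls, none of which is
  crossed outwards by a particle that is inside all of them (\<open>wall_deriv_nonpos\<close>,
  \<open>cutoff'_nonneg\<close>). The change of variables by the flow is replaced by integration by parts against
  this cutoff (\<open>weighted_integral_mono\<close>), which gives the growth of a truncated and smoothed integral of
  \<open>|f|\<close> (\<open>weighted_growth\<close>); Fatou's lemma then gives the \<open>L\<^sup>1\<close> norm.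
\<close>

section \<open>Monotone integrals along a flow\<close>

text \<open>The integral of a translate \<open>g (z + h e)\<close> over the whole space does not depend on \<open>h\<close>, and
  the integral of \<open>g'\<close> is its derivative in \<open>h\<close> at \<open>0\<close>. The hypothesis concerns
  one direction at a time because \<open>g\<close> will contain a force that is only assumed continuous.\<close>

lemma integral_directional_derivative_eq_0:
  fixes g g' :: "'a::euclidean_space \<Rightarrow> real"
  assumes deriv: "\<And>z. ((\<lambda>h. g (z + h *\<^sub>R e)) has_real_derivative g' z) (at 0)"
    and contg: "continuous_on UNIV g" and contg': "continuous_on UNIV g'"
    and supp: "\<And>z. R < norm z \<Longrightarrow> g z = 0"
    and box: "cball 0 (R + norm e) \<subseteq> cbox a b"
  shows "integral (cbox a b) g' = 0"
proof -
  define I where "I = (\<lambda>h. integral (cbox a b) (\<lambda>z. g (z + h *\<^sub>R e)))"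
  have deriv_h: "((\<lambda>h. g (z + h *\<^sub>R e)) has_vector_derivative g' (z + h *\<^sub>R e)) (at h within {-1..1})"
    for z h
  proof -
    have "((\<lambda>k. g ((z + h *\<^sub>R e) + (k - h) *\<^sub>R e)) has_real_derivative g' (z + h *\<^sub>R e)) (at h)"
      using DERIV_shift[of "\<lambda>k. g ((z + h *\<^sub>R e) + k *\<^sub>R e)" "g' (z + h *\<^sub>R e)" h "- h"]
        deriv[of "z + h *\<^sub>R e"] by simp
    moreover have "(\<lambda>k. g ((z + h *\<^sub>R e) + (k - h) *\<^sub>R e)) = (\<lambda>k. g (z + k *\<^sub>R e))"
      by (simp add: algebra_simps)
    ultimately show ?thesis
      by (simp add: has_real_derivative_iff_has_vector_derivative has_vector_derivative_at_within)
  qed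
  have "(I has_vector_derivative integral (cbox a b) (\<lambda>z. g' (z + 0 *\<^sub>R e))) (at 0 within {-1..1})"
    unfolding I_def
  proof (rule leibniz_rule_vector_derivative[OF deriv_h])
    show "(\<lambda>z. g (z + h *\<^sub>R e)) integrable_on cbox a b" for h
      by (intro integrable_continuous continuous_on_compose2[OF contg] continuous_intros) auto
    show "continuous_on ({-1..1} \<times> cbox a b) (\<lambda>(h, z). g' (z + h *\<^sub>R e))"
      unfolding split_beta
      by (intro continuous_on_compose2[OF contg'] continuous_intros) auto
  qed auto
  moreover have "I h = integral UNIV g" if h: "h \<in> {-1..1}" for h
  proof -
    let ?c = "h *\<^sub>R e"
    have outside: "g z = 0" if "z \<notin> cbox (a + ?c) (b + ?c)" for z
    proof -
      have "z - ?c \<notin> cbox a b" using that by (auto simp: mem_box inner_add_left inner_diff_left algebra_simps)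
      then have "R + norm e < norm (z - ?c)" using box by (force simp: subset_iff)
      moreover have "norm ?c \<le> norm e"
        using h by (auto simp: abs_le_iff intro!: mult_left_le_one_le)
      moreover have "norm (z - ?c) \<le> norm z + norm ?c" by (rule norm_triangle_ineq4)
      ultimately show ?thesis using supp[of z] by linarith
    qed
    have "I h = integral (cbox a b) (g \<circ> (+) ?c)" by (simp add: I_def o_def add.commute)
    also have "\<dots> = integral (cbox (a + ?c) (b + ?c)) g" by (rule integral_shift_cbox_plus)
    also have "\<dots> = integral UNIV g"
      by (rule sym, rule integral_unique, rule has_integral_on_superset[OF integrable_integral])
        (use outside in \<open>auto intro!: integrable_continuous continuous_on_subset[OF contg]\<close>)
    finally show ?thesis .
  qed
  then have "(I has_vector_derivative 0) (at 0 within {-1..1})"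
    by (intro has_vector_derivative_transform[OF _ _ has_vector_derivative_const[of "integral UNIV g"]]) auto
  ultimately show ?thesis
    using vector_derivative_unique_within_closed_interval[of "-1" 1 0 I]
    by (simp add: cbox_interval)
qed

text \<open>Since \<open>\<partial>\<^sub>t G = (\<partial>\<^sub>t G + Y \<bullet> \<nabla>G + G div Y) - div (G Y)\<close> and the integral of the last
  divergence vanishes, the time derivative of the integral of \<open>G\<close> is the integral of the bracket, which
  is assumed to be nonnegative. The derivative \<open>G' p\<close> is applied to \<open>(1, Y p)\<close>, the direction of the
  characteristic through \<open>p\<close>; the number \<open>Y' e p\<close> is the \<open>e\<close>-component's derivative in direction \<open>e\<close>,
  so that the sum of the \<open>Y' e p\<close> is the divergence.\<close>

lemma weighted_integral_mono:
  fixes G :: "real \<times> 'a::euclidean_space \<Rightarrow> real" and Y :: "real \<times> 'a \<Rightarrow> 'a"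
  assumes T: "0 \<le> T"
    and G: "\<And>p. p \<in> {0..T} \<times> UNIV \<Longrightarrow> (G has_derivative G' p) (at p within {0..T} \<times> UNIV)"
    and contG': "\<And>d. continuous_on ({0..T} \<times> UNIV) (\<lambda>p. G' p d)"
    and contY: "continuous_on ({0..T} \<times> UNIV) Y"
    and Y: "\<And>t z e. t \<in> {0..T} \<Longrightarrow> e \<in> Basis \<Longrightarrow>
      ((\<lambda>h. Y (t, z + h *\<^sub>R e) \<bullet> e) has_real_derivative Y' e (t, z)) (at 0)"
    and contY': "\<And>e. e \<in> Basis \<Longrightarrow> continuous_on ({0..T} \<times> UNIV) (Y' e)"
    and supp: "\<And>t z. t \<in> {0..T} \<Longrightarrow> R < norm z \<Longrightarrow> G (t, z) = 0"
    and pos: "\<And>p. p \<in> {0..T} \<times> UNIV \<Longrightarrow> 0 \<le> G' p (1, Y p) + (\<Sum>e\<in>Basis. Y' e p) * G p"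
    and box: "cball 0 (R + 1) \<subseteq> cbox a b"
  shows "integral (cbox a b) (\<lambda>z. G (0, z)) \<le> integral (cbox a b) (\<lambda>z. G (T, z))"
proof -
  let ?S = "{0..T} \<times> (UNIV :: 'a set)"
  define I where "I = (\<lambda>t. integral (cbox a b) (\<lambda>z. G (t, z)))"
  define D where "D = (\<lambda>t. integral (cbox a b) (\<lambda>z. G' (t, z) (1, 0)))"
  have contG: "continuous_on ?S G"
    using G by (meson continuous_on_eq_continuous_within has_derivative_continuous)
  have slice: "continuous_on UNIV (\<lambda>z. g (t, z))" if "continuous_on ?S g" "t \<in> {0..T}"
    for g :: "real \<times> 'a \<Rightarrow> 'b::topological_space" and t
    by (rule continuous_on_compose2[OF that(1)]) (use that(2) in \<open>auto intro!: continuous_intros\<close>)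
  have I_deriv: "(I has_vector_derivative D t) (at t within {0..T})" if t: "t \<in> {0..T}" for t
    unfolding I_def D_def
  proof (rule leibniz_rule_vector_derivative)
    show "((\<lambda>s. G (s, z)) has_vector_derivative G' (s, z) (1, 0)) (at s within {0..T})"
      if s: "s \<in> {0..T}" for s z
    proof -
      have "(G has_derivative G' (s, z)) (at (s, z) within (\<lambda>r. (r, z)) ` {0..T})"
        by (rule has_derivative_subset[OF G]) (use s in auto)
      then have deriv: "((\<lambda>r. G (r, z)) has_derivative (\<lambda>r. G' (s, z) (r, 0))) (at s within {0..T})"
        by (rule has_derivative_in_compose[OF has_derivative_Pair[OF has_derivative_ident has_derivative_const]])
      have "linear (G' (s, z))" using has_derivative_linear[OF G] s by auto
      then have "G' (s, z) (r *\<^sub>R (1, 0)) = r *\<^sub>R G' (s, z) (1, 0)" for r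
        by (rule linear_scale)
      then have "(\<lambda>r. G' (s, z) (r *\<^sub>R (1, 0))) = (\<lambda>r. r *\<^sub>R G' (s, z) (1, 0))"
        by (rule ext)
      moreover have "(\<lambda>r. G' (s, z) (r, 0)) = (\<lambda>r. G' (s, z) (r *\<^sub>R (1, 0)))"
        by simp
      ultimately have "(\<lambda>r. G' (s, z) (r, 0)) = (\<lambda>r. r *\<^sub>R G' (s, z) (1, 0))"
        by (rule trans[rotated])
      from has_derivative_eq_rhs[OF deriv this]
      show ?thesis unfolding has_vector_derivative_def .
    qed
    show "(\<lambda>z. G (s, z)) integrable_on cbox a b" if "s \<in> {0..T}" for s
      using slice[OF contG that] by (auto intro!: integrable_continuous intro: continuous_on_subset)
    show "continuous_on ({0..T} \<times> cbox a b) (\<lambda>(s, z). G' (s, z) (1, 0))"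
      using contG'[of "(1, 0)"] by (auto simp: split_beta intro: continuous_on_subset)
  qed (use t in auto)
  have D_nonneg: "0 \<le> D t" if t: "t \<in> {0..T}" for t
  proof -
    define F' where "F' = (\<lambda>e z. Y' e (t, z) * G (t, z) + (Y (t, z) \<bullet> e) * G' (t, z) (0, e))"
    note G'_lin = has_derivative_linear[OF G[of "(t, _)"]]
    have contF': "continuous_on UNIV (F' e)" if "e \<in> Basis" for e
      unfolding F'_def using that t
      by (intro continuous_intros slice[OF contY'] slice[OF contG] slice[OF contG'] slice[OF contY])
    have flux: "integral (cbox a b) (F' e) = 0" if e: "e \<in> Basis" for e
    proof (rule integral_directional_derivative_eq_0[where g="\<lambda>z. (Y (t, z) \<bullet> e) * G (t, z)" and e=e and R=R])
      fix z
      have "(G has_derivative G' (t, z)) (at (t, z + 0 *\<^sub>R e) within (\<lambda>h. (t, z + h *\<^sub>R e)) ` UNIV)"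
        using has_derivative_subset[OF G[of "(t, z)"], of "(\<lambda>h. (t, z + h *\<^sub>R e)) ` UNIV"] t
        by (auto simp: image_subset_iff)
      then have "((\<lambda>h. G (t, z + h *\<^sub>R e)) has_derivative (\<lambda>h. G' (t, z) (0, 0 + h *\<^sub>R e))) (at 0)"
        by (rule has_derivative_in_compose[OF has_derivative_Pair[OF has_derivative_const
          has_derivative_add[OF has_derivative_const has_derivative_scaleR_left[OF has_derivative_ident]]]])
      moreover have "G' (t, z) (0, 0 + h *\<^sub>R e) = h *\<^sub>R G' (t, z) (0, e)" for h
        using linear_scale[OF G'_lin, of z h "(0, e)"] t by simp
      ultimately have "((\<lambda>h. G (t, z + h *\<^sub>R e)) has_real_derivative G' (t, z) (0, e)) (at 0)"
        by (simp only: has_real_derivative_iff_has_vector_derivative has_vector_derivative_def)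
      from DERIV_mult[OF Y[OF t e] this]
      show "((\<lambda>h. (Y (t, z + h *\<^sub>R e) \<bullet> e) * G (t, z + h *\<^sub>R e)) has_real_derivative F' e z) (at 0)"
        by (simp add: F'_def algebra_simps)
    next
      show "continuous_on UNIV (\<lambda>z. (Y (t, z) \<bullet> e) * G (t, z))"
        by (intro continuous_intros slice[OF contY] slice[OF contG] t)
      show "continuous_on UNIV (F' e)" by (rule contF'[OF e])
    qed (use supp[OF t] box e in auto)
    let ?P = "\<lambda>z. G' (t, z) (1, 0) + (\<Sum>e\<in>Basis. F' e z)"
    have P: "?P z = G' (t, z) (1, Y (t, z)) + (\<Sum>e\<in>Basis. Y' e (t, z)) * G (t, z)" for z
    proof -
      have lin: "linear (G' (t, z))" using G'_lin t by simp
      have Y_expand: "(1, Y (t, z)) = (1, 0) + (\<Sum>e\<in>Basis. (Y (t, z) \<bullet> e) *\<^sub>R (0, e))"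
        by (simp add: prod_eq_iff fst_sum snd_sum euclidean_representation)
      have "G' (t, z) (1, Y (t, z))
          = G' (t, z) (1, 0) + (\<Sum>e\<in>Basis. (Y (t, z) \<bullet> e) * G' (t, z) (0, e))"
        unfolding Y_expand linear_add[OF lin] linear_sum[OF lin] linear_scale[OF lin] real_scaleR_def ..
      then show ?thesis
        by (simp add: F'_def sum.distrib sum_distrib_left algebra_simps)
    qed
    have int1: "(\<lambda>z. G' (t, z) (1, 0)) integrable_on cbox a b"
      using slice[OF contG' t] by (auto intro!: integrable_continuous intro: continuous_on_subset)
    have int2: "F' e integrable_on cbox a b" if "e \<in> Basis" for e
      using contF'[OF that] by (auto intro!: integrable_continuous intro: continuous_on_subset)
    have "D t = integral (cbox a b) ?P"
      using int1 int2 by (simp add: D_def integral_add integrable_sum integral_sum flux)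
    also have "\<dots> \<ge> 0"
      using int1 int2 pos t by (intro integral_nonneg integrable_add integrable_sum) (auto simp: P)
    finally show ?thesis .
  qed
  have "I 0 \<le> I T"
  proof (rule DERIV_nonneg_imp_increasing_open[OF T])
    show "\<exists>y. (I has_real_derivative y) (at t) \<and> 0 \<le> y" if "0 < t" "t < T" for t
    proof (intro exI conjI)
      show "0 \<le> D t" using D_nonneg that by simp
      show "(I has_real_derivative D t) (at t)"
        using I_deriv[of t] at_within_Icc_at[of 0 t T] that
        by (simp add: has_real_derivative_iff_has_vector_derivative)
    qed
    show "continuous_on {0..T} I"
      unfolding continuous_on_eq_continuous_within
      by (intro ballI) (rule has_vector_derivative_continuous[OF I_deriv])
  qed
  then show ?thesis by (simp add: I_def)
qed

section \<open>Cutoffs built from walls\<close>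

text \<open>The square, and not the positive part itself, so that the function is continuously
  differentiable.\<close>

definition sqpos :: "real \<Rightarrow> real" where
  "sqpos s = (max 0 s)\<^sup>2"

lemma sqpos_has_real_derivative: "(sqpos has_real_derivative 2 * max 0 s) (at s)"
proof -
  have bound: "\<bar>sqpos y - sqpos s - 2 * max 0 s * (y - s)\<bar> \<le> (y - s)\<^sup>2" for y
  proof (cases "0 \<le> s"; cases "0 \<le> y")
    assume "0 \<le> s" "\<not> 0 \<le> y"
    then have "s * y \<le> 0" "0 \<le> y * y" "0 \<le> s * s" by (simp_all add: mult_nonneg_nonpos)
    then show ?thesis using \<open>0 \<le> s\<close> \<open>\<not> 0 \<le> y\<close>
      by (simp add: sqpos_def power2_eq_square algebra_simps abs_if; (intro impI)?; linarith)
  next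
    assume "\<not> 0 \<le> s" "0 \<le> y"
    then have "s * y \<le> 0" "0 \<le> y * y" "0 \<le> s * s" by (simp_all add: mult_nonpos_nonneg)
    then show ?thesis using \<open>\<not> 0 \<le> s\<close> \<open>0 \<le> y\<close>
      by (simp add: sqpos_def power2_eq_square algebra_simps abs_if; (intro impI)?; linarith)
  next
    assume "0 \<le> s" "0 \<le> y"
    then have "sqpos y - sqpos s - 2 * max 0 s * (y - s) = (y - s)\<^sup>2"
      by (simp add: sqpos_def power2_eq_square algebra_simps)
    then show ?thesis by simp
  qed (simp add: sqpos_def)
  have quotient: "a / d - m = (a - m * d) / d" if "d \<noteq> 0" for a d m :: real
    using that by (simp add: diff_divide_distrib)
  have "((\<lambda>y. (sqpos y - sqpos s) / (y - s) - 2 * max 0 s) \<longlongrightarrow> 0) (at s)"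
  proof (rule Lim_null_comparison)
    show "\<forall>\<^sub>F y in at s. norm ((sqpos y - sqpos s) / (y - s) - 2 * max 0 s) \<le> \<bar>y - s\<bar>"
      unfolding eventually_at_filter
    proof (intro always_eventually allI impI)
      fix y assume "y \<noteq> s"
      then have ys: "y - s \<noteq> 0" by simp
      have "norm ((sqpos y - sqpos s) / (y - s) - 2 * max 0 s)
          = \<bar>sqpos y - sqpos s - 2 * max 0 s * (y - s)\<bar> / \<bar>y - s\<bar>"
        unfolding quotient[OF ys] real_norm_def abs_divide ..
      also have "\<dots> \<le> (y - s)\<^sup>2 / \<bar>y - s\<bar>"
        by (rule divide_right_mono[OF bound]) simp
      also have "\<dots> = \<bar>y - s\<bar>"
        using ys by (metis abs_mult_self_eq nonzero_mult_div_cancel_left abs_eq_0 power2_eq_square)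
      finally show "norm ((sqpos y - sqpos s) / (y - s) - 2 * max 0 s) \<le> \<bar>y - s\<bar>" .
    qed
    show "((\<lambda>y. \<bar>y - s\<bar>) \<longlongrightarrow> 0) (at s)" by (auto intro!: tendsto_eq_intros)
  qed
  then show ?thesis unfolding has_field_derivative_iff by (rule LIM_zero_cancel)
qed

text \<open>A family of walls \<open>g i\<close> is turned into one cutoff: it is \<open>1\<close> where all \<open>g i\<close> are nonpositive
  and \<open>0\<close> as soon as one of them reaches \<open>1\<close>. Penalties are added before the outer function is applied,
  because then a direction in which every wall value decreases is one in which the cutoff increases. The
  companion \<open>cutoff'\<close> is the directional derivative, \<open>g' i\<close> being that of \<open>g i\<close>.\<close>

definition cutoff :: "('i \<Rightarrow> real) \<Rightarrow> 'i set \<Rightarrow> real" where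
  "cutoff g I = sqpos (1 - (\<Sum>i\<in>I. sqpos (g i)))"

definition cutoff' :: "('i \<Rightarrow> real) \<Rightarrow> ('i \<Rightarrow> real) \<Rightarrow> 'i set \<Rightarrow> real" where
  "cutoff' g g' I = - 2 * max 0 (1 - (\<Sum>i\<in>I. sqpos (g i))) * (\<Sum>i\<in>I. 2 * max 0 (g i) * g' i)"

lemma cutoff_has_derivative:
  assumes "\<And>i. i \<in> I \<Longrightarrow> (g i has_derivative g' i) (at p within S)"
  shows "((\<lambda>p. cutoff (\<lambda>i. g i p) I) has_derivative
    (\<lambda>d. cutoff' (\<lambda>i. g i p) (\<lambda>i. g' i d) I)) (at p within S)"
proof -
  have "((\<lambda>p. 1 - (\<Sum>i\<in>I. sqpos (g i p))) has_derivative
      (\<lambda>d. 0 - (\<Sum>i\<in>I. g' i d * (2 * max 0 (g i p))))) (at p within S)"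
    by (intro has_derivative_diff has_derivative_const has_derivative_sum
        DERIV_compose_FDERIV[OF sqpos_has_real_derivative] assms)
  from DERIV_compose_FDERIV[OF sqpos_has_real_derivative this]
  show ?thesis
    unfolding cutoff_def
    by (rule has_derivative_eq_rhs) (auto simp: cutoff'_def fun_eq_iff algebra_simps sum_distrib_left sum_negf)
qed

lemma below_1_if_penalties_below_1:
  assumes "finite I" "(\<Sum>i\<in>I. sqpos (g i)) < 1" "i \<in> I"
  shows "g i < 1"
proof -
  have "sqpos (g i) \<le> (\<Sum>i\<in>I. sqpos (g i))"
    using assms by (intro member_le_sum) (auto simp: sqpos_def)
  then have "(max 0 (g i))\<^sup>2 < 1\<^sup>2" using assms(2) by (simp add: sqpos_def)
  then show ?thesis by (smt (verit) power2_less_imp_less)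
qed

lemma cutoff_nonneg: "0 \<le> cutoff g I"
  by (simp add: cutoff_def sqpos_def)

lemma cutoff_le_1: "cutoff g I \<le> 1"
proof -
  have "0 \<le> (\<Sum>i\<in>I. sqpos (g i))" by (intro sum_nonneg) (auto simp: sqpos_def)
  then show ?thesis by (auto simp: cutoff_def sqpos_def intro!: power_le_one)
qed

lemma cutoff_eq_0:
  assumes "finite I" "i \<in> I" "1 \<le> g i"
  shows "cutoff g I = 0"
  using below_1_if_penalties_below_1[of I g i] assms
  by (fastforce simp: cutoff_def sqpos_def[of "1 - _"])

lemma cutoff_eq_1:
  assumes "\<And>i. i \<in> I \<Longrightarrow> g i \<le> 0"
  shows "cutoff g I = 1"
proof -
  have "(\<Sum>i\<in>I. sqpos (g i)) = 0" using assms by (intro sum.neutral) (auto simp: sqpos_def)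
  then show ?thesis by (simp add: cutoff_def sqpos_def)
qed

text \<open>The sign of \<open>g' i\<close> is only asked for where all walls are below \<open>1\<close>. This is what replaces a
  continuity argument along characteristics: bounds that hold inside all walls may be used to show that
  each single wall is respected.\<close>

lemma cutoff'_nonneg:
  assumes "finite I" and "(\<And>i. i \<in> I \<Longrightarrow> g i < 1) \<Longrightarrow> (\<And>i. i \<in> I \<Longrightarrow> g' i \<le> 0)"
  shows "0 \<le> cutoff' g g' I"
proof (cases "(\<Sum>i\<in>I. sqpos (g i)) < 1")
  case True
  then have "g' i \<le> 0" if "i \<in> I" for i
    using assms below_1_if_penalties_below_1[OF assms(1) True] that by blast
  then have "(\<Sum>i\<in>I. 2 * max 0 (g i) * g' i) \<le> 0"
    by (intro sum_nonpos mult_nonneg_nonpos) auto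
  then show ?thesis unfolding cutoff'_def
    by (intro mult_nonpos_nonpos) auto
next
  case False
  then show ?thesis by (simp add: cutoff'_def)
qed

lemma continuous_on_cutoff':
  assumes "\<And>i. i \<in> I \<Longrightarrow> continuous_on S (\<lambda>p. g p i)" "\<And>i. i \<in> I \<Longrightarrow> continuous_on S (\<lambda>p. g' p i)"
  shows "continuous_on S (\<lambda>p. cutoff' (g p) (g' p) I)"
  unfolding cutoff'_def sqpos_def using assms by (intro continuous_intros) auto

text \<open>A continuously differentiable substitute for the absolute value that vanishes at \<open>0\<close> and lies
  below it. Any such function of a transported density is again transported.\<close>

definition smooth_abs :: "real \<Rightarrow> real \<Rightarrow> real" where
  "smooth_abs \<delta> s = sqrt (\<delta>\<^sup>2 + s\<^sup>2) - \<delta>"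

lemma smooth_abs_has_real_derivative:
  assumes "0 < \<delta>"
  shows "(smooth_abs \<delta> has_real_derivative s / sqrt (\<delta>\<^sup>2 + s\<^sup>2)) (at s)"
proof -
  have "0 < \<delta>\<^sup>2 + s\<^sup>2" using assms by (simp add: add_pos_nonneg)
  then show ?thesis
    unfolding smooth_abs_def by (auto intro!: derivative_eq_intros simp: field_simps)
qed

lemma smooth_abs_bounds:
  assumes "0 < \<delta>"
  shows "0 \<le> smooth_abs \<delta> s" "smooth_abs \<delta> s \<le> \<bar>s\<bar>" "\<bar>s\<bar> - \<delta> \<le> smooth_abs \<delta> s"
proof -
  have "\<delta> \<le> sqrt (\<delta>\<^sup>2 + s\<^sup>2)" using assms by (simp add: real_le_rsqrt)
  then show "0 \<le> smooth_abs \<delta> s" by (simp add: smooth_abs_def)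
  show "smooth_abs \<delta> s \<le> \<bar>s\<bar>"
    using sqrt_sum_squares_le_sum_abs[of \<delta> s] assms by (simp add: smooth_abs_def)
  show "\<bar>s\<bar> - \<delta> \<le> smooth_abs \<delta> s" by (simp add: smooth_abs_def real_le_rsqrt)
qed

section \<open>The walls\<close>

lemma jbracket_pos: "0 < jbracket z" "1 \<le> jbracket z"
  by (simp_all add: jbracket_def add_pos_nonneg)

lemma jbracket_vec3_squared: "(jbracket (v :: vec3))\<^sup>2 = 1 + (v $ 1)\<^sup>2 + (v $ 2)\<^sup>2 + (v $ 3)\<^sup>2"
  by (simp add: jbracket_def power2_norm_eq_inner inner_vec_def sum_3 flip: power2_eq_square)

text \<open>The six walls around the particles that are followed; \<open>Slow\<close> and \<open>Fast\<close> bound \<open>v\<^sup>1\<close> from below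
  and above, \<open>Sideways\<close> bounds \<open>(v\<^sup>2, v\<^sup>3)\<close>, \<open>Behind\<close> and \<open>Ahead\<close> bound \<open>x\<^sup>1 - t\<close>, and \<open>Offaxis\<close> bounds
  \<open>(x\<^sup>2, x\<^sup>3)\<close>.\<close>

datatype wall = Slow | Fast | Sideways | Behind | Ahead | Offaxis

lemma finite_UNIV_wall: "finite (UNIV :: wall set)"
proof (rule finite_subset)
  show "(UNIV :: wall set) \<subseteq> {Slow, Fast, Sideways, Behind, Ahead, Offaxis}"
    using wall.exhaust by blast
qed simp

text \<open>A bound for how far the particles fall behind the speed of light, or move away from the axis,
  up to time \<open>t\<close>. It stays below \<open>1\<close>, while its derivative \<open>16 (1 + t)\<^bsup>-17\<^esup>\<close> dominates both rates as
  soon as \<open>2 v\<^sup>1\<close> is at least \<open>(1 + t)\<^bsup>17\<^esup>\<close>.\<close>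

definition drift :: "real \<Rightarrow> real" where
  "drift t = 1 - (1 + t) powr (- 16)"

text \<open>A particle is inside a wall while the value is below \<open>1\<close>; the initial data satisfy \<open>\<le> 0\<close>. A force
  of at least \<open>k / (1 + t)\<close> makes \<open>v\<^sup>1\<close> grow at least like \<open>(1 + t)\<^bsup>k\<^esup>\<close>, which is the rate in \<open>Slow\<close>. The
  rate \<open>M\<close> in \<open>Fast\<close> comes from a crude bound of the force on a bounded time interval; this wall only
  serves to make the region bounded. \<open>K\<close> is the largest initial \<open>v\<^sup>1\<close> that is followed.\<close>

primrec wall_fun :: "real \<Rightarrow> real \<Rightarrow> real \<Rightarrow> wall \<Rightarrow> real \<times> vec3 \<times> vec3 \<Rightarrow> real" where
  "wall_fun k M K Slow = (\<lambda>(t, x, v). 2 * (1 - v $ 1 * (1 + t) powr (- k)))"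
| "wall_fun k M K Fast = (\<lambda>(t, x, v). v $ 1 * exp (- (M * t)) / K - 1)"
| "wall_fun k M K Sideways = (\<lambda>(t, x, v). (v $ 2)\<^sup>2 + (v $ 3)\<^sup>2 - 2)"
| "wall_fun k M K Behind = (\<lambda>(t, x, v). t - x $ 1 + 6 - drift t)"
| "wall_fun k M K Ahead = (\<lambda>(t, x, v). 2 * (x $ 1 - t - 8))"
| "wall_fun k M K Offaxis = (\<lambda>(t, x, v). (x $ 2)\<^sup>2 + (x $ 3)\<^sup>2 - 1 - drift t)"

primrec wall_deriv ::
  "real \<Rightarrow> real \<Rightarrow> real \<Rightarrow> wall \<Rightarrow> real \<times> vec3 \<times> vec3 \<Rightarrow> real \<times> vec3 \<times> vec3 \<Rightarrow> real" where
  "wall_deriv k M K Slow = (\<lambda>(t, x, v) (\<tau>, \<xi>, \<eta>).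
     - 2 * (\<eta> $ 1 * (1 + t) powr (- k) - k * v $ 1 * (1 + t) powr (- k - 1) * \<tau>))"
| "wall_deriv k M K Fast = (\<lambda>(t, x, v) (\<tau>, \<xi>, \<eta>). exp (- (M * t)) / K * (\<eta> $ 1 - M * v $ 1 * \<tau>))"
| "wall_deriv k M K Sideways = (\<lambda>(t, x, v) (\<tau>, \<xi>, \<eta>). 2 * (v $ 2 * \<eta> $ 2 + v $ 3 * \<eta> $ 3))"
| "wall_deriv k M K Behind = (\<lambda>(t, x, v) (\<tau>, \<xi>, \<eta>). \<tau> - \<xi> $ 1 - 16 * (1 + t) powr (- 17) * \<tau>)"
| "wall_deriv k M K Ahead = (\<lambda>(t, x, v) (\<tau>, \<xi>, \<eta>). 2 * (\<xi> $ 1 - \<tau>))"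
| "wall_deriv k M K Offaxis = (\<lambda>(t, x, v) (\<tau>, \<xi>, \<eta>).
     2 * (x $ 2 * \<xi> $ 2 + x $ 3 * \<xi> $ 3) - 16 * (1 + t) powr (- 17) * \<tau>)"

lemma powr_shift_has_derivative:
  fixes p :: "real \<times> 'a::real_normed_vector"
  assumes "0 \<le> fst p"
  shows "((\<lambda>p. (1 + fst p) powr a) has_derivative (\<lambda>d. a * (1 + fst p) powr (a - 1) * fst d)) (at p within S)"
proof -
  have "((\<lambda>s. (1 + s) powr a) has_real_derivative a * (1 + fst p) powr (a - 1)) (at (fst p))"
    using assms by (auto intro!: derivative_eq_intros)
  from DERIV_compose_FDERIV[OF this has_derivative_fst[OF has_derivative_ident]]
  show ?thesis by (simp add: mult.commute)
qed

lemma wall_fun_has_derivative: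
  assumes "0 \<le> fst p"
  shows "(wall_fun k M K w has_derivative wall_deriv k M K w p) (at p within S)"
proof -
  note [derivative_intros] = powr_shift_has_derivative[OF assms]
    bounded_linear.has_derivative[OF bounded_linear_vec_nth]
  show ?thesis
  proof (cases w)
    case Slow
    then show ?thesis
      by (auto simp: split_beta fun_eq_iff algebra_simps intro!: derivative_eq_intros)
  next
    case Fast
    then show ?thesis
      by (auto simp: split_beta fun_eq_iff diff_divide_distrib algebra_simps divide_inverse intro!: derivative_eq_intros)
  next
    case Sideways
    then show ?thesis
      by (auto simp: split_beta fun_eq_iff algebra_simps intro!: derivative_eq_intros)
  next
    case Behind
    then show ?thesis
      by (auto simp: drift_def split_beta fun_eq_iff algebra_simps intro!: derivative_eq_intros)
  next
    case Ahead
    then show ?thesis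
      by (auto simp: split_beta fun_eq_iff algebra_simps intro!: derivative_eq_intros)
  next
    case Offaxis
    then show ?thesis
      by (auto simp: drift_def split_beta fun_eq_iff algebra_simps intro!: derivative_eq_intros)
  qed
qed

lemma continuous_on_wall_fun:
  assumes "S \<subseteq> {0..} \<times> UNIV"
  shows "continuous_on S (wall_fun k M K w)"
proof -
  have "1 + fst p \<noteq> 0" if "p \<in> S" for p using assms that by (cases p) auto
  then show ?thesis
    by (cases w) (auto simp: drift_def split_beta divide_inverse intro!: continuous_intros)
qed

lemma continuous_on_wall_deriv:
  assumes "S \<subseteq> {0..} \<times> UNIV"
  shows "continuous_on S (\<lambda>p. wall_deriv k M K w p d)"
proof -
  have "1 + fst p \<noteq> 0" if "p \<in> S" for p using assms that by (cases p) auto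
  then show ?thesis
    by (cases w; cases d) (auto simp: drift_def split_beta divide_inverse intro!: continuous_intros)
qed

lemma vhat_component: "vhat v $ i = v $ i / jbracket v"
  by (simp add: vhat_def divide_inverse)

text \<open>The velocity, in phase space, of a particle in a force \<open>F\<close> that acts along the first axis;
  \<open>F\<close> stands for \<open>\<partial>\<^bsub>x\<^sup>1\<^esub> A\<close>.\<close>

definition phase_velocity :: "(real \<times> vec3 \<Rightarrow> real) \<Rightarrow> real \<times> vec3 \<times> vec3 \<Rightarrow> vec3 \<times> vec3" where
  "phase_velocity F = (\<lambda>(t, x, v). (vhat v, (jbracket v * F (t, x)) *\<^sub>R axis 1 1))"

text \<open>The slack between the values \<open>0\<close> and \<open>1\<close> and the bound \<open>drift t \<le> 1\<close> together leave \<open>x\<^sup>1 - t\<close>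
  between \<open>4\<close> and \<open>17/2\<close> and the particle near the axis, which keeps \<open>t - |x|\<close> in \<open>[-10, -1]\<close>, where the profile is explicit. The
  estimate \<open>\<langle>v\<rangle> \<le> 5 v\<^sup>1\<close> says that a fixed fraction of the speed of light points along the axis.\<close>

lemma inside_walls:
  assumes t: "0 \<le> t" and k: "17 \<le> k" and K: "0 < K"
    and inside: "\<And>w. wall_fun k M K w (t, x, v) < 1"
  shows "(1 + t) powr k < 2 * v $ 1" "1 < 2 * v $ 1" "(v $ 2)\<^sup>2 + (v $ 3)\<^sup>2 < 3"
    "v $ 1 < 2 * K * exp (M * t)" "jbracket v \<le> 5 * v $ 1"
    "t + 4 < x $ 1" "x $ 1 < t + 17 / 2" "(x $ 2)\<^sup>2 + (x $ 3)\<^sup>2 < 3"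
proof -
  have "v $ 1 * (1 + t) powr (- k) > 1 / 2" using inside[of Slow] by simp
  then show v1: "(1 + t) powr k < 2 * v $ 1"
    using t by (simp add: powr_minus field_simps)
  have "1 \<le> (1 + t) powr k" using t k by (simp add: ge_one_powr_ge_zero)
  with v1 show v1': "1 < 2 * v $ 1" by simp
  show v23: "(v $ 2)\<^sup>2 + (v $ 3)\<^sup>2 < 3" using inside[of Sideways] by simp
  have "v $ 1 / (K * exp (M * t)) < 2" using inside[of Fast] by (simp add: exp_minus field_simps)
  then show "v $ 1 < 2 * K * exp (M * t)" using K by (simp add: field_simps)
  have "(1 / 2)\<^sup>2 \<le> (v $ 1)\<^sup>2" using v1' by (intro power_mono) auto
  then have "(jbracket v)\<^sup>2 \<le> (5 * v $ 1)\<^sup>2"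
    unfolding jbracket_vec3_squared power_mult_distrib power_divide using v23 by simp
  then show "jbracket v \<le> 5 * v $ 1" by (rule power2_le_imp_le) (use v1' in auto)
  have drift: "drift t \<le> 1" by (simp add: drift_def)
  show "t + 4 < x $ 1" using inside[of Behind] drift by simp
  show "x $ 1 < t + 17 / 2" using inside[of Ahead] by simp
  show "(x $ 2)\<^sup>2 + (x $ 3)\<^sup>2 < 3" using inside[of Offaxis] drift by simp
qed

text \<open>No wall is crossed outwards. Against \<open>Slow\<close> and \<open>Fast\<close> the force acts at the assumed rates; the
  components \<open>v\<^sup>2, v\<^sup>3\<close> are constant. \<open>Ahead\<close> moves at the speed of light.
  \<open>Behind\<close> and \<open>Offaxis\<close> use that \<open>1 - v\<^sup>1/\<langle>v\<rangle>\<close> and the transverse speed are of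
  order \<open>1 / v\<^sup>1\<close>, hence of order \<open>(1 + t)\<^bsup>-17\<^esup>\<close>, which the derivative of \<open>drift\<close> absorbs.\<close>

lemma wall_deriv_nonpos:
  assumes t: "0 \<le> t" and k: "17 \<le> k" and K: "0 < K"
    and inside: "\<And>w. wall_fun k M K w (t, x, v) < 1"
    and force: "k / (1 + t) \<le> F (t, x)" "5 * F (t, x) \<le> M"
  shows "wall_deriv k M K w (t, x, v) (1, phase_velocity F (t, x, v)) \<le> 0"
proof -
  note bounds = inside_walls[OF t k K inside]
  let ?J = "jbracket v"
  have v1: "0 < v $ 1" using bounds(2) by simp
  have F: "0 \<le> F (t, x)" using force(1) t k by (smt (verit) divide_nonneg_nonneg)
  have J: "v $ 1 \<le> ?J"
    by (rule power2_le_imp_le) (use jbracket_pos[of v] in \<open>auto simp: jbracket_vec3_squared\<close>)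
  have inv_v1: "1 / v $ 1 \<le> 2 * (1 + t) powr (- 17)"
  proof -
    have "(1 + t) powr 17 \<le> (1 + t) powr k" using t k by (intro powr_mono) auto
    then have "(1 + t) powr 17 \<le> 2 * v $ 1" using bounds(1) by simp
    then show ?thesis using v1 t by (simp add: powr_minus field_simps)
  qed
  show ?thesis
  proof (cases w)
    case Slow
    have "k * v $ 1 / (1 + t) \<le> ?J * F (t, x)"
      using mult_mono[OF J force(1)] jbracket_pos[of v] k t by (simp add: mult.commute)
    then have "(k * v $ 1 / (1 + t)) * (1 + t) powr (- k) \<le> ?J * F (t, x) * (1 + t) powr (- k)"
      by (rule mult_right_mono) simp
    moreover have "(1 + t) powr (- k - 1) = (1 + t) powr (- k) / (1 + t)"
      using t by (simp add: powr_diff)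
    ultimately show ?thesis using Slow by (simp add: phase_velocity_def)
  next
    case Fast
    have "?J * F (t, x) \<le> (5 * v $ 1) * F (t, x)" using bounds(5) F by (rule mult_right_mono)
    also have "\<dots> \<le> M * v $ 1" using mult_left_mono[OF force(2), of "v $ 1"] v1 by (simp add: algebra_simps)
    finally show ?thesis using Fast K
      by (simp add: phase_velocity_def mult_nonneg_nonpos divide_nonpos_pos)
  next
    case Sideways
    then show ?thesis by (simp add: phase_velocity_def axis_def)
  next
    case Behind
    \<comment> \<open>Squaring, \<open>1 + (v\<^sup>2)\<^sup>2 + (v\<^sup>3)\<^sup>2 \<le> 4\<close> is what has to be compared with the mixed term.\<close>
    have "?J \<le> v $ 1 + 2 / v $ 1"
    proof (rule power2_le_imp_le)
      show "?J\<^sup>2 \<le> (v $ 1 + 2 / v $ 1)\<^sup>2"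
      proof -
        have "(v $ 1 + 2 / v $ 1)\<^sup>2 = (v $ 1)\<^sup>2 + 4 + (2 / v $ 1)\<^sup>2"
          using v1 by (simp add: power2_sum)
        moreover have "0 \<le> (2 / v $ 1)\<^sup>2" by simp
        ultimately show ?thesis
          using bounds(3) unfolding jbracket_vec3_squared by linarith
      qed
    qed (use v1 in auto)
    then have "?J - v $ 1 \<le> 2 * (1 / v $ 1) * 1" by simp
    also have "\<dots> \<le> 2 * (1 / v $ 1) * ?J"
      using v1 jbracket_pos[of v] by (intro mult_left_mono) auto
    finally have "1 - v $ 1 / ?J \<le> 2 * (1 / v $ 1)"
      using jbracket_pos[of v] by (simp add: field_simps)
    then have "1 - v $ 1 / ?J \<le> 16 * (1 + t) powr (- 17)"
      using inv_v1 powr_ge_zero[of "1 + t" "- 17"] by linarith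
    then show ?thesis using Behind
      by (simp add: phase_velocity_def vhat_component)
  next
    case Ahead
    have "v $ 1 / ?J \<le> 1" using J jbracket_pos[of v] by simp
    then show ?thesis using Ahead by (simp add: phase_velocity_def vhat_component)
  next
    case Offaxis
    have "0 \<le> (x $ 2 - v $ 2)\<^sup>2 + (x $ 3 - v $ 3)\<^sup>2" by simp
    then have "x $ 2 * v $ 2 + x $ 3 * v $ 3 \<le> 3"
      using bounds(3,8) by (simp add: power2_diff)
    then have "(x $ 2 * v $ 2 + x $ 3 * v $ 3) / ?J \<le> 3 / ?J"
      using jbracket_pos[of v] by (intro divide_right_mono) auto
    also have "\<dots> \<le> 3 / v $ 1" using J v1 by (intro divide_left_mono) auto
    also have "\<dots> = 3 * (1 / v $ 1)" by simp
    finally have "2 * ((x $ 2 * v $ 2 + x $ 3 * v $ 3) / ?J) \<le> 16 * (1 + t) powr (- 17)"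
      using inv_v1 powr_ge_zero[of "1 + t" "- 17"] by linarith
    then show ?thesis using Offaxis
      by (simp add: phase_velocity_def vhat_component add_divide_distrib)
  qed
qed

section \<open>The force of the free wave\<close>

lemma norm_near_first_component:
  fixes x :: vec3
  assumes "4 \<le> x $ 1" "(x $ 2)\<^sup>2 + (x $ 3)\<^sup>2 \<le> 3"
  shows "x $ 1 \<le> norm x" "norm x \<le> x $ 1 + 1"
proof -
  have sq: "(norm x)\<^sup>2 = (x $ 1)\<^sup>2 + ((x $ 2)\<^sup>2 + (x $ 3)\<^sup>2)"
    by (simp add: power2_norm_eq_inner inner_vec_def sum_3 flip: power2_eq_square)
  show "x $ 1 \<le> norm x" using component_le_norm_cart[of x 1] by simp
  show "norm x \<le> x $ 1 + 1"
    by (rule power2_le_imp_le) (use assms sq in \<open>auto simp: power2_sum\<close>)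
qed

text \<open>At time \<open>0\<close> the derivative is relative to a half space, but spatial directions run inside it, so
  restricting to a line gives uniqueness in these directions.\<close>

lemma pd_slab_space_eq:
  assumes g: "(g has_derivative D) (at (t, x) within slab \<infinity>)" and t: "0 \<le> t"
  shows "pd (slab \<infinity>) (0, e) g (t, x) = D (0, e)"
proof -
  have line: "((\<lambda>h. g (t, x + h *\<^sub>R e)) has_real_derivative D' (0, e)) (at 0)"
    if D': "(g has_derivative D') (at (t, x) within slab \<infinity>)" for D'
  proof -
    have "(g has_derivative D') (at (t, x + 0 *\<^sub>R e) within (\<lambda>h. (t, x + h *\<^sub>R e)) ` UNIV)"
      using has_derivative_subset[OF D', of "(\<lambda>h. (t, x + h *\<^sub>R e)) ` UNIV"] t
      by (auto simp: image_subset_iff slab_def)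
    then have "((\<lambda>h. g (t, x + h *\<^sub>R e)) has_derivative (\<lambda>h. D' (0, 0 + h *\<^sub>R e))) (at 0)"
      by (rule has_derivative_in_compose[OF has_derivative_Pair[OF has_derivative_const
          has_derivative_add[OF has_derivative_const has_derivative_scaleR_left[OF has_derivative_ident]]]])
    moreover have "D' (0, 0 + h *\<^sub>R e) = h *\<^sub>R D' (0, e)" for h
      using linear_scale[OF has_derivative_linear[OF D'], of h "(0, e)"] by simp
    ultimately show ?thesis
      by (simp only: has_real_derivative_iff_has_vector_derivative has_vector_derivative_def)
  qed
  have "g differentiable (at (t, x) within slab \<infinity>)" using g by (auto simp: differentiable_def)
  then show ?thesis
    unfolding pd_def frechet_derivative_works using DERIV_unique[OF line line[OF g]] by blast
qed

text \<open>In the channel \<open>\<A>(u) = e\<^bsup>-2u\<^esup>\<close> with \<open>u = t - |x|\<close> and \<open>r = |x|\<close>, hence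
  \<open>\<partial>\<^bsub>x\<^sup>1\<^esub> (\<A>(u)/r) = (x\<^sup>1/r) e\<^bsup>-2u\<^esup> (2/r - 1/r\<^sup>2)\<close>. The term from differentiating the exponential
  wins because \<open>r > 4\<close>, and \<open>r\<close> is at most a multiple of \<open>1 + t\<close>.\<close>

lemma pd_A_hom_lower_bound:
  assumes "\<forall>u\<in>{-10..-1}. \<A> u = exp (- 2 * u)" and t: "0 \<le> t"
    and x: "t + 4 < x $ 1" "x $ 1 < t + 17 / 2" "(x $ 2)\<^sup>2 + (x $ 3)\<^sup>2 < 3"
  shows "1 / (20 * (1 + t)) \<le> pd (slab \<infinity>) (0, axis 1 1) (A_hom \<A>) (t, x)"
proof -
  define r where "r = norm x"
  define u where "u = t - r"
  have r: "x $ 1 \<le> r" "r \<le> x $ 1 + 1" "4 < r"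
    using norm_near_first_component[of x] x t by (auto simp: r_def)
  have x_nz: "x \<noteq> 0" using r by (auto simp: r_def)
  have u: "- 10 < u" "u < - 1" using r x by (auto simp: u_def)
  have "((\<lambda>u. exp (- 2 * u)) has_real_derivative - 2 * exp (- 2 * u)) (at u)"
    by (auto intro!: derivative_eq_intros)
  then have A': "(\<A> has_real_derivative - 2 * exp (- 2 * u)) (at u)"
    by (rule has_field_derivative_transform_within_open[of _ _ _ "{-10<..<-1}"]) (use assms(1) u in auto)
  have norm': "((\<lambda>p :: real \<times> vec3. norm (snd p)) has_derivative (\<lambda>d. snd d \<bullet> sgn x)) (at (t, x) within slab \<infinity>)"
    by (rule has_derivative_eq_rhs, rule has_derivative_compose[OF has_derivative_snd[OF has_derivative_ident] has_derivative_norm])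
      (use r in \<open>auto simp: r_def\<close>)
  have "((\<lambda>p :: real \<times> vec3. fst p - norm (snd p)) has_derivative (\<lambda>d. fst d - snd d \<bullet> sgn x)) (at (t, x) within slab \<infinity>)"
    by (intro has_derivative_diff norm' has_derivative_fst has_derivative_ident)
  then have "((\<lambda>p :: real \<times> vec3. \<A> (fst p - norm (snd p))) has_derivative
      (\<lambda>d. (fst d - snd d \<bullet> sgn x) * (- 2 * exp (- 2 * u)))) (at (t, x) within slab \<infinity>)"
    by (rule DERIV_compose_FDERIV[rotated]) (use A' in \<open>simp add: u_def r_def\<close>)
  from has_derivative_divide[OF this norm']
  have "(A_hom \<A> has_derivative (\<lambda>d. - \<A> u * (inverse r * (snd d \<bullet> sgn x) * inverse r)
      + (fst d - snd d \<bullet> sgn x) * (- 2 * exp (- 2 * u)) / r)) (at (t, x) within slab \<infinity>)"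
    using r x_nz by (auto simp: A_hom_def case_prod_beta' u_def r_def)
  from pd_slab_space_eq[OF this t, of "axis 1 1"]
  have "pd (slab \<infinity>) (0, axis 1 1) (A_hom \<A>) (t, x)
      = x $ 1 / r * exp (- 2 * u) * (2 / r - 1 / r\<^sup>2)"
    using assms(1) u r
    by (simp add: inner_axis' sgn_div_norm r_def[symmetric] field_simps power2_eq_square)
  also have "\<dots> \<ge> 1 / 2 * 1 * (1 / r)"
  proof (intro mult_mono)
    show "1 / 2 \<le> x $ 1 / r" using r by (simp add: field_simps)
    show "1 \<le> exp (- 2 * u)" using u by simp
    show "1 / r \<le> 2 / r - 1 / r\<^sup>2" using r by (simp add: field_simps power2_eq_square)
  qed (use r in auto)
  also have "1 / 2 * 1 * (1 / r) \<ge> 1 / (20 * (1 + t))"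
    using r x t by (simp add: field_simps)
  finally show ?thesis by simp
qed

section \<open>Growth of the integral\<close>

lemma jbracket_directional_derivative:
  fixes v e :: "'a::real_inner"
  shows "((\<lambda>h. jbracket (v + h *\<^sub>R e)) has_real_derivative (v \<bullet> e) / jbracket v) (at 0)"
proof -
  have eq: "jbracket (v + h *\<^sub>R e) = sqrt (1 + (norm v)\<^sup>2 + 2 * h * (v \<bullet> e) + h\<^sup>2 * (norm e)\<^sup>2)" for h
    unfolding jbracket_def power2_norm_eq_inner
    by (simp add: inner_add_left inner_add_right inner_commute power2_eq_square algebra_simps)
  have pos: "0 < 1 + (norm v)\<^sup>2" by (simp add: add_pos_nonneg)
  show ?thesis
    unfolding eq jbracket_def[of v] using pos
    by (auto intro!: derivative_eq_intros simp: field_simps)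
qed

lemma continuous_on_jbracket [continuous_intros]:
  "continuous_on S g \<Longrightarrow> continuous_on S (\<lambda>p. jbracket (g p))"
  unfolding jbracket_def by (intro continuous_intros)

text \<open>The contribution of direction \<open>e\<close> to the divergence of the phase velocity. Only the \<open>v\<^sup>1\<close>
  direction contributes: \<open>F\<close> depends on time and position alone, and \<open>\<partial>\<^bsub>v\<^sup>1\<^esub> \<langle>v\<rangle> = v\<^sup>1/\<langle>v\<rangle>\<close>.\<close>

definition phase_divergence :: "(real \<times> vec3 \<Rightarrow> real) \<Rightarrow> vec3 \<times> vec3 \<Rightarrow> real \<times> vec3 \<times> vec3 \<Rightarrow> real" where
  "phase_divergence F e = (\<lambda>(t, x, v). if e = (0, axis 1 1) then v $ 1 / jbracket v * F (t, x) else 0)"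

lemma phase_velocity_component_derivative:
  assumes "e \<in> Basis"
  shows "((\<lambda>h. phase_velocity F (t, z + h *\<^sub>R e) \<bullet> e) has_real_derivative phase_divergence F e (t, z)) (at 0)"
proof -
  obtain x v where z: "z = (x, v)" by (cases z)
  from assms consider (space) a where "e = (a, 0)" | (velocity) i where "e = (0, axis i 1)"
    by (auto simp: Basis_prod_def Basis_vec_def)
  then show ?thesis
  proof cases
    case space
    then have "e \<noteq> (0, axis 1 1)" by (simp add: axis_eq_0_iff)
    then show ?thesis using space by (simp add: z phase_velocity_def phase_divergence_def)
  next
    case velocity
    show ?thesis
    proof (cases "i = 1")
      case True
      have "((\<lambda>h. jbracket (v + h *\<^sub>R axis 1 1) * F (t, x)) has_real_derivative
          (v \<bullet> axis 1 1) / jbracket v * F (t, x)) (at 0)"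
        by (intro DERIV_cmult_right jbracket_directional_derivative)
      then show ?thesis using velocity True
        by (simp add: z phase_velocity_def phase_divergence_def inner_axis)
    next
      case False
      then show ?thesis using velocity
        by (simp add: z phase_velocity_def phase_divergence_def inner_axis_axis axis_eq_axis)
    qed
  qed
qed

lemma sum_phase_divergence:
  "(\<Sum>e\<in>Basis. phase_divergence F e (t, x, v)) = v $ 1 / jbracket v * F (t, x)"
proof -
  have "(0, axis 1 1) \<in> (Basis :: (vec3 \<times> vec3) set)" by (simp add: Basis_prod_def)
  then show ?thesis by (simp add: phase_divergence_def)
qed

lemma continuous_on_phase_velocity:
  assumes "continuous_on (I \<times> UNIV) F"
  shows "continuous_on (I \<times> UNIV) (phase_velocity F)"
    and "continuous_on (I \<times> UNIV) (phase_divergence F e)"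
proof -
  have nz: "jbracket v \<noteq> 0" for v :: vec3 using jbracket_pos[of v] by simp
  have F: "continuous_on (I \<times> UNIV) (\<lambda>p :: real \<times> vec3 \<times> vec3. F (fst p, fst (snd p)))"
    by (rule continuous_on_compose2[OF assms]) (auto intro!: continuous_intros)
  show "continuous_on (I \<times> UNIV) (phase_velocity F)"
    unfolding phase_velocity_def case_prod_beta' vhat_def by (intro continuous_intros F) (use nz in auto)
  show "continuous_on (I \<times> UNIV) (phase_divergence F e)"
    unfolding phase_divergence_def case_prod_beta'
    by (cases "e = (0, axis 1 1)") (use nz in \<open>auto intro!: continuous_intros F\<close>)
qed

text \<open>The partial derivatives are values of one linear map, whose continuity in every direction follows
  from that along the basis; this allows differentiating along characteristics.\<close>

lemma Ck_on_1_derivative: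
  assumes "Ck_on 1 S g"
  shows "p \<in> S \<Longrightarrow> (g has_derivative frechet_derivative g (at p within S)) (at p within S)"
    and "continuous_on S (\<lambda>p. frechet_derivative g (at p within S) d)"
proof -
  have diff: "g differentiable_on S" and cont: "\<And>b. b \<in> Basis \<Longrightarrow> continuous_on S (pd S b g)"
    using assms by (auto simp: numeral_eq_Suc)
  show D: "(g has_derivative frechet_derivative g (at p within S)) (at p within S)" if "p \<in> S" for p
    using diff that by (auto simp: differentiable_on_def frechet_derivative_works)
  have "frechet_derivative g (at p within S) d = (\<Sum>b\<in>Basis. (d \<bullet> b) * pd S b g p)" if "p \<in> S" for p
  proof -
    note lin = has_derivative_linear[OF D[OF that]]
    have "frechet_derivative g (at p within S) (\<Sum>b\<in>Basis. (d \<bullet> b) *\<^sub>R b) = (\<Sum>b\<in>Basis. (d \<bullet> b) * pd S b g p)"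
      unfolding linear_sum[OF lin] linear_scale[OF lin] pd_def real_scaleR_def ..
    then show ?thesis by (simp add: euclidean_representation)
  qed
  moreover have "continuous_on S (\<lambda>p. \<Sum>b\<in>Basis. (d \<bullet> b) * pd S b g p)"
    by (intro continuous_intros cont)
  ultimately show "continuous_on S (\<lambda>p. frechet_derivative g (at p within S) d)"
    by (simp cong: continuous_on_cong)
qed

text \<open>What the walls say about positions. It involves neither \<open>K\<close> nor \<open>M\<close>, so that a lower bound
  of the force can be assumed here before \<open>M\<close> is chosen.\<close>

definition in_channel :: "real \<Rightarrow> vec3 \<Rightarrow> bool" where
  "in_channel t x \<longleftrightarrow> t + 4 < x $ 1 \<and> x $ 1 < t + 17 / 2 \<and> (x $ 2)\<^sup>2 + (x $ 3)\<^sup>2 < 3"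

lemma wall_fun_initial_nonpos:
  assumes "0 < K" "norm (x - vector [7, 0, 0]) \<le> 1"
    and "0 \<le> v $ 2" "v $ 2 \<le> 1" "0 \<le> v $ 3" "v $ 3 \<le> 1" "1 \<le> v $ 1" "v $ 1 \<le> K"
  shows "wall_fun k M K w (0, x, v) \<le> 0"
proof -
  have "(norm (x - vector [7, 0, 0]))\<^sup>2 \<le> 1" using assms(2) by (simp add: power_le_one)
  then have sq: "(x $ 1 - 7)\<^sup>2 + (x $ 2)\<^sup>2 + (x $ 3)\<^sup>2 \<le> 1"
    by (simp add: power2_norm_eq_inner inner_vec_def sum_3 flip: power2_eq_square)
  then have "(x $ 1 - 7)\<^sup>2 \<le> 1" "(x $ 2)\<^sup>2 + (x $ 3)\<^sup>2 \<le> 1"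
    by (smt (verit) zero_le_power2)+
  moreover from this have "6 \<le> x $ 1" "x $ 1 \<le> 8" by (auto simp: abs_square_le_1 abs_le_iff)
  moreover have "(v $ 2)\<^sup>2 + (v $ 3)\<^sup>2 \<le> 1 + 1" using assms by (intro add_mono power_le_one) auto
  ultimately show ?thesis
    using assms by (cases w) (auto simp: drift_def)
qed

lemma nn_integral_continuous_compact_support:
  fixes g :: "'a::euclidean_space \<Rightarrow> real"
  assumes "continuous_on UNIV g" "\<And>z. 0 \<le> g z" "\<And>z. z \<notin> cbox a b \<Longrightarrow> g z = 0"
  shows "(\<integral>\<^sup>+z. ennreal (g z) \<partial>lborel) = ennreal (integral (cbox a b) g)"
proof (rule nn_integral_has_integral_lborel)
  show "g \<in> borel_measurable borel" using assms(1) by (rule borel_measurable_continuous_onI)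
  show "(g has_integral integral (cbox a b) g) UNIV"
    using assms by (intro has_integral_on_superset[OF integrable_integral] integrable_continuous)
      (auto intro: continuous_on_subset)
qed (rule assms(2))

text \<open>The integral of \<open>(1 + t)\<^bsup>-k/5\<^esup> cutoff smooth_abs(f)\<close> does not decrease: \<open>f\<close> is transported, the
  cutoff does not decrease along characteristics, and inside the walls the divergence
  \<open>(v\<^sup>1/\<langle>v\<rangle>) F \<ge> (1/5) k / (1 + t)\<close> compensates the loss from the power of \<open>1 + t\<close>. Initially the cutoff is
  \<open>1\<close> on the part of the support with \<open>v\<^sup>1 \<le> K\<close>; at time \<open>T\<close> the integrand is below \<open>|f|\<close>. Truncating
  in \<open>v\<^sup>1\<close> and smoothing the absolute value make the integrand compactly supported and continuously
  differentiable; both are removed afterwards.\<close>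

lemma weighted_growth:
  assumes f: "Ck_on 1 (slab \<infinity>) f"
    and F: "continuous_on (slab \<infinity>) F"
    and transport: "\<And>p. p \<in> slab \<infinity> \<Longrightarrow>
      frechet_derivative f (at p within slab \<infinity>) (1, phase_velocity F p) = 0"
    and force: "\<And>t x. 0 \<le> t \<Longrightarrow> in_channel t x \<Longrightarrow> k / (1 + t) \<le> F (t, x)"
    and initial: "\<And>x v. f (0, x, v) \<noteq> 0 \<Longrightarrow> norm (x - vector [7, 0, 0]) \<le> 1 \<and>
        0 \<le> v $ 2 \<and> v $ 2 \<le> 1 \<and> 0 \<le> v $ 3 \<and> v $ 3 \<le> 1 \<and> 1 \<le> v $ 1"
    and k: "17 \<le> k" and T: "0 \<le> T" and K: "0 < K" and \<delta>: "0 < \<delta>"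
  shows "(\<integral>\<^sup>+z. ennreal ((1 + T) powr (k / 5) *
      (indicator {z. snd z $ 1 \<le> K} z * smooth_abs \<delta> (f (0, z)))) \<partial>lborel) \<le> L1_norm (\<lambda>z. f (T, z))"
proof -
  let ?S = "{0..T} \<times> (UNIV :: (vec3 \<times> vec3) set)"
  have slab_sub: "?S \<subseteq> slab \<infinity>" by (auto simp: slab_def)
  have "compact ({0..T} \<times> cball (0 :: vec3) (T + 12))" by (intro compact_Times) auto
  then have "compact (F ` ({0..T} \<times> cball 0 (T + 12)))"
    by (intro compact_continuous_image continuous_on_subset[OF F]) (auto simp: slab_def)
  then obtain M0 where "\<forall>y\<in>F ` ({0..T} \<times> cball 0 (T + 12)). norm y \<le> M0"
    using compact_imp_bounded bounded_iff by blast
  then have M0: "\<bar>F (t, x)\<bar> \<le> M0" if "t \<in> {0..T}" "norm x \<le> T + 12" for t x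
    using that by auto
  \<comment> \<open>The factor \<open>5\<close> is that of \<open>\<langle>v\<rangle> \<le> 5 v\<^sup>1\<close>, since \<open>v\<^sup>1\<close> changes at rate \<open>\<langle>v\<rangle> F\<close>.\<close>
  define M where "M = 5 * M0"
  have "0 \<le> M" using M0[of 0 0] T by (auto simp: M_def)
  define g where "g = (\<lambda>p i. wall_fun k M K i p)"
  define W where "W = (\<lambda>p. (1 + fst p) powr (- (k / 5)) * cutoff (g p) UNIV)"
  define W' where "W' = (\<lambda>p d. (1 + fst p) powr (- (k / 5)) * cutoff' (g p) (\<lambda>i. wall_deriv k M K i p d) UNIV
     + (- (k / 5) * (1 + fst p) powr (- (k / 5) - 1) * fst d) * cutoff (g p) UNIV)"
  define Df where "Df = (\<lambda>p. frechet_derivative f (at p within slab \<infinity>))"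
  define h where "h = (\<lambda>p. smooth_abs \<delta> (f p))"
  define h' where "h' = (\<lambda>p d. Df p d * (f p / sqrt (\<delta>\<^sup>2 + (f p)\<^sup>2)))"
  define G where "G = (\<lambda>p. W p * h p)"
  define G' where "G' = (\<lambda>p d. W p * h' p d + W' p d * h p)"

  have inside: "in_channel t x" "norm x \<le> T + 12" "norm v \<le> 10 * K * exp (M * T)"
      "5 * F (t, x) \<le> M" "k / (1 + t) \<le> F (t, x)" "1 / 5 \<le> v $ 1 / jbracket v"
    if t: "t \<in> {0..T}" and walls: "\<And>w. g (t, x, v) w < 1" for t x v
  proof -
    have "0 \<le> t" using t by simp
    note b = inside_walls[OF this k K walls[unfolded g_def]]
    show ch: "in_channel t x" using b by (simp add: in_channel_def)
    then show "k / (1 + t) \<le> F (t, x)" using force t by simp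
    show x: "norm x \<le> T + 12"
      using norm_near_first_component[of x] b t by simp
    show "5 * F (t, x) \<le> M" using M0[OF t x] by (simp add: M_def)
    show "1 / 5 \<le> v $ 1 / jbracket v" using b(5) jbracket_pos[of v] by (simp add: field_simps)
    have "norm v \<le> jbracket v" unfolding jbracket_def by (rule real_le_rsqrt) simp
    also have "\<dots> \<le> 10 * K * exp (M * t)" using b(4,5) by simp
    also have "\<dots> \<le> 10 * K * exp (M * T)"
      using K t \<open>0 \<le> M\<close> by (intro mult_left_mono) (auto intro: mult_left_mono)
    finally show "norm v \<le> 10 * K * exp (M * T)" .
  qed
  define R where "R = (T + 12) + 10 * K * exp (M * T)"
  have cut_zero: "cutoff (g p) UNIV = 0" if "\<not> (\<forall>w. g p w < 1)" for p
  proof -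
    from that obtain w where "1 \<le> g p w" by (auto simp: not_less)
    then show ?thesis by (rule cutoff_eq_0[OF finite_UNIV_wall UNIV_I])
  qed
  have supp: "G (t, z) = 0" if t: "t \<in> {0..T}" and z: "R < norm z" for t z
  proof (cases "\<forall>w. g (t, z) w < 1")
    case True
    obtain x v where xv: "z = (x, v)" by (cases z)
    have "norm z \<le> norm x + norm v" unfolding xv by (rule norm_Pair_le)
    also have "\<dots> \<le> R" using inside(2,3)[OF t, of x v] True xv by (force simp: R_def)
    finally show ?thesis using z by simp
  qed (simp add: cut_zero G_def W_def)
  obtain a where box: "cball 0 (R + 1) \<subseteq> cbox (- a) (a :: vec3 \<times> vec3)"
    using bounded_subset_cbox_symmetric[OF bounded_cball] by metis
  have h_nonneg: "0 \<le> h p" for p using smooth_abs_bounds(1)[OF \<delta>] by (simp add: h_def)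
  have W_nonneg: "0 \<le> W p" for p by (simp add: W_def cutoff_nonneg)

  have G_deriv: "(G has_derivative G' p) (at p within ?S)" if p: "p \<in> ?S" for p
  proof -
    have t: "0 \<le> fst p" using p by auto
    have "(f has_derivative Df p) (at p within ?S)"
      using has_derivative_subset[OF Ck_on_1_derivative(1)[OF f] slab_sub] p slab_sub by (auto simp: Df_def)
    from DERIV_compose_FDERIV[OF smooth_abs_has_real_derivative[OF \<delta>] this]
    have "(h has_derivative h' p) (at p within ?S)" by (simp add: h_def h'_def)
    moreover have "(W has_derivative W' p) (at p within ?S)"
      unfolding W_def W'_def g_def
      by (intro has_derivative_mult powr_shift_has_derivative[OF t] cutoff_has_derivative wall_fun_has_derivative t)
    ultimately show ?thesis unfolding G_def G'_def by (intro has_derivative_mult)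
  qed
  have contf: "continuous_on ?S f"
    using Ck_on_1_derivative(1)[OF f] slab_sub
    by (meson continuous_on_eq_continuous_within continuous_on_subset has_derivative_continuous)
  have G'_cont: "continuous_on ?S (\<lambda>p. G' p d)" for d
  proof -
    have S_sub: "?S \<subseteq> {0..} \<times> UNIV" by auto
    have root: "sqrt (\<delta>\<^sup>2 + s\<^sup>2) \<noteq> 0" for s using \<delta> by (simp add: add_pos_nonneg less_imp_neq[symmetric])
    have base: "1 + fst p \<noteq> 0" if "p \<in> ?S" for p using that by auto
    have g_cont: "continuous_on ?S (\<lambda>p. g p i)" for i
      unfolding g_def by (rule continuous_on_wall_fun[OF S_sub])
    have "continuous_on ?S (\<lambda>p. Df p d)"
      unfolding Df_def by (rule continuous_on_subset[OF Ck_on_1_derivative(2)[OF f] slab_sub])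
    then show ?thesis
      unfolding G'_def W_def W'_def h_def h'_def smooth_abs_def
      using root base
      by (intro continuous_intros continuous_on_cutoff' g_cont continuous_on_wall_deriv[OF S_sub] contf)
        (auto simp: cutoff_def sqpos_def intro!: continuous_intros g_cont)
  qed
  have F': "continuous_on ({0..T} \<times> UNIV) F"
    by (rule continuous_on_subset[OF F]) (auto simp: slab_def)

  have mono: "integral (cbox (- a) a) (\<lambda>z. G (0, z)) \<le> integral (cbox (- a) a) (\<lambda>z. G (T, z))"
  proof (rule weighted_integral_mono[where Y="phase_velocity F" and Y'="phase_divergence F" and R=R,
        OF T G_deriv G'_cont continuous_on_phase_velocity(1)[OF F'] phase_velocity_component_derivative
        continuous_on_phase_velocity(2)[OF F'] supp _ box])
    fix p :: "real \<times> vec3 \<times> vec3" assume p: "p \<in> ?S"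
    obtain t x v where txv: "p = (t, x, v)" by (cases p)
    have t: "t \<in> {0..T}" using p txv by simp
    let ?d = "(1, phase_velocity F p)" and ?C = "cutoff (g p) UNIV"
    let ?q = "(1 + t) powr (- (k / 5))"
    have "Df p ?d = 0" unfolding Df_def using transport p slab_sub by blast
    then have G'_eq: "G' p ?d = W' p ?d * h p" by (simp add: G'_def h'_def)
    have C': "0 \<le> cutoff' (g p) (\<lambda>i. wall_deriv k M K i p ?d) UNIV"
    proof (rule cutoff'_nonneg)
      fix i assume walls: "\<And>i. i \<in> UNIV \<Longrightarrow> g p i < 1"
      then have walls': "\<And>w. g (t, x, v) w < 1" by (simp add: txv)
      have "wall_deriv k M K i (t, x, v) (1, phase_velocity F (t, x, v)) \<le> 0"
        using t by (intro wall_deriv_nonpos[OF _ k K walls'[unfolded g_def]] inside(4,5)[OF t walls']) simp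
      then show "wall_deriv k M K i p ?d \<le> 0" by (simp add: txv)
    qed (rule finite_UNIV_wall)
    have C: "0 \<le> (v $ 1 / jbracket v * F (t, x) - k / 5 / (1 + t)) * ?C"
    proof (cases "\<forall>w. g p w < 1")
      case True
      then have walls: "\<And>w. g (t, x, v) w < 1" by (simp add: txv)
      have "1 / 5 * (k / (1 + t)) \<le> v $ 1 / jbracket v * F (t, x)"
        by (rule mult_mono[OF inside(6,5)[OF t walls]])
          (use inside(6)[OF t walls] k t in \<open>auto intro: order_trans[of 0 "1 / 5"]\<close>)
      then show ?thesis by (intro mult_nonneg_nonneg cutoff_nonneg) simp
    qed (simp add: cut_zero)
    have "(1 + t) powr (- (k / 5) - 1) = ?q / (1 + t)" using t by (simp add: powr_diff)
    then have "W' p ?d + v $ 1 / jbracket v * F (t, x) * W p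
        = ?q * cutoff' (g p) (\<lambda>i. wall_deriv k M K i p ?d) UNIV
          + ?q * ((v $ 1 / jbracket v * F (t, x) - k / 5 / (1 + t)) * ?C)"
      by (simp add: W'_def W_def txv algebra_simps)
    also have "\<dots> \<ge> 0" using C C' by simp
    finally have "0 \<le> (W' p ?d + v $ 1 / jbracket v * F (t, x) * W p) * h p"
      using h_nonneg by simp
    then show "0 \<le> G' p ?d + (\<Sum>e\<in>Basis. phase_divergence F e p) * G p"
      unfolding G'_eq by (simp add: txv sum_phase_divergence G_def algebra_simps)
  qed

  have slice: "continuous_on UNIV (\<lambda>z. G (t, z))" if "t \<in> {0..T}" for t
  proof -
    have "continuous_on ?S G"
      unfolding continuous_on_eq_continuous_within by (intro ballI) (rule has_derivative_continuous[OF G_deriv])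
    then show ?thesis
      by (rule continuous_on_compose2) (use that in \<open>auto intro!: continuous_intros\<close>)
  qed
  have nn: "(\<integral>\<^sup>+z. ennreal (G (t, z)) \<partial>lborel) = ennreal (integral (cbox (- a) a) (\<lambda>z. G (t, z)))"
    if t: "t \<in> {0..T}" for t
  proof (rule nn_integral_continuous_compact_support[OF slice[OF t]])
    show "0 \<le> G (t, z)" for z using W_nonneg h_nonneg by (simp add: G_def)
    show "G (t, z) = 0" if "z \<notin> cbox (- a) a" for z
    proof (rule supp[OF t])
      have "z \<notin> cball 0 (R + 1)" using that box by blast
      then show "R < norm z" by simp
    qed
  qed
  let ?c = "(1 + T) powr (k / 5)"
  have start: "?c * (indicator {z. snd z $ 1 \<le> K} z * h (0, z)) \<le> ?c * G (0, z)" for z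
  proof (intro mult_left_mono)
    obtain x v where z: "z = (x, v)" by (cases z)
    show "indicator {z. snd z $ 1 \<le> K} z * h (0, z) \<le> G (0, z)"
    proof (cases "v $ 1 \<le> K \<and> f (0, z) \<noteq> 0")
      case True
      then have "g (0, z) w \<le> 0" for w
        using wall_fun_initial_nonpos[OF K, of x v] initial[of x v] by (simp add: z g_def)
      then have "G (0, z) = h (0, z)" by (simp add: G_def W_def cutoff_eq_1)
      then show ?thesis using True by (simp add: z)
    next
      case False
      then have "indicator {z. snd z $ 1 \<le> K} z * h (0, z) = 0"
        using \<delta> by (auto simp: z h_def smooth_abs_def)
      also have "0 \<le> G (0, z)" unfolding G_def by (intro mult_nonneg_nonneg W_nonneg h_nonneg)
      finally show ?thesis .
    qed
  qed simp
  have finish: "?c * G (T, z) \<le> \<bar>f (T, z)\<bar>" for z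
  proof -
    have "?c * G (T, z) = cutoff (g (T, z)) UNIV * h (T, z)"
      using T by (simp add: G_def W_def powr_minus)
    also have "\<dots> \<le> 1 * \<bar>f (T, z)\<bar>"
      using smooth_abs_bounds[OF \<delta>] by (intro mult_mono cutoff_le_1) (auto simp: h_def)
    finally show ?thesis by simp
  qed
  have meas: "(\<lambda>z. ennreal (G (t, z))) \<in> borel_measurable lborel" if "t \<in> {0..T}" for t
    using borel_measurable_continuous_onI[OF slice[OF that]] by simp
  have "(\<integral>\<^sup>+z. ennreal (?c * (indicator {z. snd z $ 1 \<le> K} z * h (0, z))) \<partial>lborel)
      \<le> (\<integral>\<^sup>+z. ennreal ?c * ennreal (G (0, z)) \<partial>lborel)"
    using start by (intro nn_integral_mono) (simp add: ennreal_leI flip: ennreal_mult')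
  also have "\<dots> = ennreal ?c * ennreal (integral (cbox (- a) a) (\<lambda>z. G (0, z)))"
    using T by (simp add: nn_integral_cmult[OF meas] nn)
  also have "\<dots> \<le> ennreal ?c * ennreal (integral (cbox (- a) a) (\<lambda>z. G (T, z)))"
    by (intro mult_left_mono ennreal_leI mono) simp
  also have "\<dots> = (\<integral>\<^sup>+z. ennreal ?c * ennreal (G (T, z)) \<partial>lborel)"
    using T by (simp add: nn_integral_cmult[OF meas] nn)
  also have "\<dots> \<le> (\<integral>\<^sup>+z. ennreal \<bar>f (T, z)\<bar> \<partial>lborel)"
    using finish by (intro nn_integral_mono) (simp add: ennreal_leI flip: ennreal_mult')
  finally show ?thesis by (simp add: L1_norm_def h_def)
qed

lemma smooth_abs_tendsto:
  "(\<lambda>n. smooth_abs (1 / real (Suc n)) s) \<longlonglongrightarrow> \<bar>s\<bar>"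
proof -
  have "(\<lambda>n. 1 / real (Suc n)) \<longlonglongrightarrow> 0" by (rule LIMSEQ_inverse_real_of_nat[unfolded inverse_eq_divide])
  then have "(\<lambda>n. sqrt ((1 / real (Suc n))\<^sup>2 + s\<^sup>2) - 1 / real (Suc n)) \<longlonglongrightarrow> sqrt (0\<^sup>2 + s\<^sup>2) - 0"
    by (intro tendsto_intros)
  then show ?thesis by (simp add: smooth_abs_def)
qed

text \<open>Fatou's lemma along \<open>K = n + 1\<close> and \<open>\<delta> = 1 / (n + 1)\<close>.\<close>

lemma L1_norm_growth:
  assumes f: "Ck_on 1 (slab \<infinity>) f"
    and F: "continuous_on (slab \<infinity>) F"
    and transport: "\<And>p. p \<in> slab \<infinity> \<Longrightarrow>
      frechet_derivative f (at p within slab \<infinity>) (1, phase_velocity F p) = 0"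
    and force: "\<And>t x. 0 \<le> t \<Longrightarrow> in_channel t x \<Longrightarrow> k / (1 + t) \<le> F (t, x)"
    and initial: "\<And>x v. f (0, x, v) \<noteq> 0 \<Longrightarrow> norm (x - vector [7, 0, 0]) \<le> 1 \<and>
        0 \<le> v $ 2 \<and> v $ 2 \<le> 1 \<and> 0 \<le> v $ 3 \<and> v $ 3 \<le> 1 \<and> 1 \<le> v $ 1"
    and k: "17 \<le> k" and T: "0 \<le> T"
  shows "L1_norm (\<lambda>z. f (0, z)) * ennreal ((1 + T) powr (k / 5)) \<le> L1_norm (\<lambda>z. f (T, z))"
proof -
  let ?c = "(1 + T) powr (k / 5)"
  define u where "u = (\<lambda>n z. ?c * (indicator {z. snd z $ 1 \<le> real (Suc n)} z
    * smooth_abs (1 / real (Suc n)) (f (0, z))))"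
  have f0: "continuous_on UNIV (\<lambda>z. f (0, z))"
  proof (rule continuous_on_compose2[where g=f and f="Pair 0" and s=UNIV])
    show "continuous_on (slab \<infinity>) f"
      unfolding continuous_on_eq_continuous_within
      by (intro ballI) (rule has_derivative_continuous[OF Ck_on_1_derivative(1)[OF f]])
  qed (auto simp: slab_def intro!: continuous_intros)
  have [measurable]: "(\<lambda>z. f (0, z)) \<in> borel_measurable borel"
    by (rule borel_measurable_continuous_onI[OF f0])
  have u_meas: "(\<lambda>z. ennreal (u n z)) \<in> borel_measurable lborel" for n
  proof -
    have "closed {z :: vec3 \<times> vec3. snd z $ 1 \<le> real (Suc n)}"
      by (intro closed_Collect_le continuous_intros)
    then have [measurable]: "{z :: vec3 \<times> vec3. snd z $ 1 \<le> real (Suc n)} \<in> sets borel" by simp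
    show ?thesis unfolding u_def smooth_abs_def by measurable
  qed
  have u_lim: "(\<lambda>n. ennreal (u n z)) \<longlonglongrightarrow> ennreal ?c * ennreal \<bar>f (0, z)\<bar>" for z
  proof -
    have "(\<lambda>n. u n z) \<longlonglongrightarrow> ?c * \<bar>f (0, z)\<bar>"
    proof (rule Lim_transform_eventually)
      show "(\<lambda>n. ?c * smooth_abs (1 / real (Suc n)) (f (0, z))) \<longlonglongrightarrow> ?c * \<bar>f (0, z)\<bar>"
        by (intro tendsto_intros smooth_abs_tendsto)
      have "\<forall>\<^sub>F n in sequentially. snd z $ 1 \<le> real (Suc n)"
        using eventually_ge_at_top[of "nat \<lceil>snd z $ 1\<rceil>"] by eventually_elim linarith
      then show "\<forall>\<^sub>F n in sequentially. ?c * smooth_abs (1 / real (Suc n)) (f (0, z)) = u n z"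
        by eventually_elim (simp add: u_def)
    qed
    then show ?thesis by (simp add: tendsto_ennrealI flip: ennreal_mult')
  qed
  have "L1_norm (\<lambda>z. f (0, z)) * ennreal ?c = (\<integral>\<^sup>+z. ennreal ?c * ennreal \<bar>f (0, z)\<bar> \<partial>lborel)"
    unfolding L1_norm_def by (subst nn_integral_cmult) (auto simp: mult.commute)
  also have "\<dots> = (\<integral>\<^sup>+z. liminf (\<lambda>n. ennreal (u n z)) \<partial>lborel)"
    by (intro nn_integral_cong lim_imp_Liminf[symmetric] u_lim) simp
  also have "\<dots> \<le> liminf (\<lambda>n. \<integral>\<^sup>+z. ennreal (u n z) \<partial>lborel)"
    by (rule nn_integral_liminf[OF u_meas])
  also have "\<dots> \<le> limsup (\<lambda>n. \<integral>\<^sup>+z. ennreal (u n z) \<partial>lborel)"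
    by (rule Liminf_le_Limsup) simp
  also have "\<dots> \<le> L1_norm (\<lambda>z. f (T, z))"
    unfolding u_def
    by (intro Limsup_bounded always_eventually allI
        weighted_growth[OF f F transport force initial k T]) auto
  finally show ?thesis .
qed

section \<open>Application to the coupled system\<close>

lemma solution_transport:
  assumes sol: "solution \<infinity> f A" and p: "p \<in> slab \<infinity>"
  shows "frechet_derivative f (at p within slab \<infinity>)
    (1, phase_velocity (pd (slab \<infinity>) (0, axis 1 1) A) p) = 0"
proof -
  obtain t x v where txv: "p = (t, x, v)" by (cases p)
  let ?D = "frechet_derivative f (at p within slab \<infinity>)"
  have "Ck_on 1 (slab \<infinity>) f" using sol by (simp add: solution_def)
  from Ck_on_1_derivative(1)[OF this p] have lin: "linear ?D" by (rule has_derivative_linear)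
  let ?c = "jbracket v * pd (slab \<infinity>) (0, axis 1 1) A (t, x)"
  have "(\<Sum>i\<in>UNIV. (vhat v $ i) *\<^sub>R (axis i 1 :: vec3)) = vhat v"
    by (simp add: vec_eq_iff axis_def sum_component if_distrib cong: if_cong)
  then have dir: "(1, phase_velocity (pd (slab \<infinity>) (0, axis 1 1) A) p)
      = (1, 0, 0) + (\<Sum>i\<in>UNIV. (vhat v $ i) *\<^sub>R (0, axis i 1, 0)) + ?c *\<^sub>R (0, 0, axis 1 1)"
    by (simp add: txv phase_velocity_def prod_eq_iff fst_sum snd_sum)
  have "?D (1, phase_velocity (pd (slab \<infinity>) (0, axis 1 1) A) p)
      = ?D (1, 0, 0) + (\<Sum>i\<in>UNIV. vhat v $ i * ?D (0, axis i 1, 0)) + ?c * ?D (0, 0, axis 1 1)"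
    unfolding dir linear_add[OF lin] linear_sum[OF lin] linear_scale[OF lin] real_scaleR_def ..
  also have "\<dots> = 0"
    using sol p unfolding solution_def pd_def txv by blast
  finally show ?thesis .
qed

lemma Ck_on_2_pd_continuous:
  assumes "Ck_on 2 S g" "b \<in> Basis"
  shows "continuous_on S (pd S b g)"
  using assms by (auto simp: numeral_2_eq_2 intro: differentiable_imp_continuous_on)

text \<open>The free wave contributes at least \<open>\<Lambda> / (20 (1 + t))\<close> and the deviation takes away at most
  \<open>1/\<langle>t\<rangle> \<le> 2 / (1 + t)\<close>. That half of the former is left needs \<open>\<Lambda> \<ge> 80\<close>; the larger threshold makes
  \<open>\<Lambda> / 40 \<ge> 17\<close>, the growth rate that the walls need.\<close>

lemma force_lower_bound:
  assumes \<A>: "\<forall>u\<in>{-10..-1}. \<A> u = exp (- 2 * u)"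
    and \<Lambda>: "680 \<le> \<Lambda>" and t: "0 \<le> t" and channel: "in_channel t x"
    and close: "jbracket t * \<bar>F - \<Lambda> * pd (slab \<infinity>) (0, axis 1 1) (A_hom \<A>) (t, x)\<bar> \<le> 1"
  shows "\<Lambda> / 40 / (1 + t) \<le> F"
proof -
  let ?P = "pd (slab \<infinity>) (0, axis 1 1) (A_hom \<A>) (t, x)"
  have P: "1 / (20 * (1 + t)) \<le> ?P"
    using channel by (intro pd_A_hom_lower_bound[OF \<A> t]) (auto simp: in_channel_def)
  have "((1 + t) / 2)\<^sup>2 \<le> 1 + t\<^sup>2"
    using zero_le_power2[of "t - 1"] t by (simp add: power2_eq_square algebra_simps)
  then have J: "(1 + t) / 2 \<le> jbracket t"
    unfolding jbracket_def real_norm_def power2_abs by (rule real_le_rsqrt)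
  have "(1 + t) / 2 * \<bar>F - \<Lambda> * ?P\<bar> \<le> jbracket t * \<bar>F - \<Lambda> * ?P\<bar>"
    using J by (rule mult_right_mono) simp
  also note close
  finally have "\<bar>F - \<Lambda> * ?P\<bar> \<le> 2 / (1 + t)" using t by (simp add: field_simps)
  moreover have "\<Lambda> * (1 / (20 * (1 + t))) \<le> \<Lambda> * ?P" using P \<Lambda> by (intro mult_left_mono) auto
  moreover have "2 / (1 + t) \<le> \<Lambda> / 40 / (1 + t)" using t \<Lambda> by (intro divide_right_mono) auto
  moreover have "\<Lambda> * (1 / (20 * (1 + t))) = 2 * (\<Lambda> / 40 / (1 + t))"
    using t by (simp add: divide_simps)
  ultimately show ?thesis by linarith
qed

theorem proposition1p8:
  fixes \<A> :: "real \<Rightarrow> real"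
  assumes "radial_profile \<A>"
  shows "\<exists>c>0. \<forall>f0. initial_density f0 \<longrightarrow>
    (\<exists>\<Lambda>0>0. \<forall>\<Lambda>\<ge>\<Lambda>0. \<forall>Clarge>0. \<forall>\<epsilon>1>0. \<exists>\<epsilon>>0. \<epsilon> \<le> \<epsilon>1 \<and>
      (\<forall>T f A. maximal_solution \<A> \<Lambda> \<epsilon> f0 T f A \<longrightarrow>
         T < \<infinity>
       \<or> (\<forall>t\<ge>0. L1_norm (\<lambda>(x, v). f (t, x, v)) \<ge>
            L1_norm (\<lambda>(x, v). f (0, x, v)) * ennreal ((1 + t) powr (c * \<Lambda>)))
       \<or> (\<exists>(t, x)\<in>slab T.
            jbracket t * \<bar>pd (slab T) (0, axis 1 1) A (t, x)
              - \<Lambda> * pd (slab T) (0, axis 1 1) (A_hom \<A>) (t, x)\<bar> \<ge> Clarge * \<epsilon>)))"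
proof (rule exI[of _ "1 / 200"], intro conjI allI impI)
  fix f0 assume f0: "initial_density f0"
  show "\<exists>\<Lambda>0>0. \<forall>\<Lambda>\<ge>\<Lambda>0. \<forall>Clarge>0. \<forall>\<epsilon>1>0. \<exists>\<epsilon>>0. \<epsilon> \<le> \<epsilon>1 \<and>
      (\<forall>T f A. maximal_solution \<A> \<Lambda> \<epsilon> f0 T f A \<longrightarrow>
         T < \<infinity>
       \<or> (\<forall>t\<ge>0. L1_norm (\<lambda>(x, v). f (t, x, v)) \<ge>
            L1_norm (\<lambda>(x, v). f (0, x, v)) * ennreal ((1 + t) powr (1 / 200 * \<Lambda>)))
       \<or> (\<exists>(t, x)\<in>slab T.
            jbracket t * \<bar>pd (slab T) (0, axis 1 1) A (t, x)
              - \<Lambda> * pd (slab T) (0, axis 1 1) (A_hom \<A>) (t, x)\<bar> \<ge> Clarge * \<epsilon>))"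
  proof (rule exI[of _ 680], intro conjI allI impI)
    fix \<Lambda> C \<epsilon>1 :: real assume \<Lambda>: "680 \<le> \<Lambda>" and C: "0 < C" and \<epsilon>1: "0 < \<epsilon>1"
    \<comment> \<open>With this choice a deviation below \<open>C \<epsilon> / \<langle>t\<rangle>\<close> is below \<open>1/\<langle>t\<rangle>\<close>, however large \<open>C\<close> is.\<close>
    define \<epsilon> where "\<epsilon> = min \<epsilon>1 (1 / C)"
    have C\<epsilon>: "C * \<epsilon> \<le> 1" using C by (simp add: \<epsilon>_def min_def field_simps)
    have growth: "L1_norm (\<lambda>(x, v). f (0, x, v)) * ennreal ((1 + t) powr (1 / 200 * \<Lambda>))
          \<le> L1_norm (\<lambda>(x, v). f (t, x, v))"
      if max: "maximal_solution \<A> \<Lambda> \<epsilon> f0 T f A" and "\<not> T < \<infinity>" and t: "0 \<le> t"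
        and no_dev: "\<not> (\<exists>(t, x)\<in>slab T.
            jbracket t * \<bar>pd (slab T) (0, axis 1 1) A (t, x)
              - \<Lambda> * pd (slab T) (0, axis 1 1) (A_hom \<A>) (t, x)\<bar> \<ge> C * \<epsilon>)"
      for T f A t
    proof -
      have T: "T = \<infinity>" using that by simp
      have sol: "solution \<infinity> f A" and data: "\<And>x v. f (0, x, v) = \<epsilon> * f0 (x, v)"
        using max by (auto simp: maximal_solution_def has_data_def T)
      let ?F = "pd (slab \<infinity>) (0, axis 1 1) A"
      have f: "Ck_on 1 (slab \<infinity>) f" and A: "Ck_on 2 (slab \<infinity>) A"
        using sol by (auto simp: solution_def)
      have F: "continuous_on (slab \<infinity>) ?F"
        by (rule Ck_on_2_pd_continuous[OF A]) (simp add: Basis_prod_def)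
      have force: "\<Lambda> / 40 / (1 + t) \<le> ?F (t, x)" if t: "0 \<le> t" and ch: "in_channel t x" for t x
      proof (rule force_lower_bound[OF _ \<Lambda> t ch])
        show "\<forall>u\<in>{- 10..- 1}. \<A> u = exp (- 2 * u)" using assms by (simp add: radial_profile_def)
        have "(t, x) \<in> slab \<infinity>" using t by (simp add: slab_def)
        then have "jbracket t * \<bar>?F (t, x) - \<Lambda> * pd (slab \<infinity>) (0, axis 1 1) (A_hom \<A>) (t, x)\<bar> < C * \<epsilon>"
          using no_dev unfolding T by force
        then show "jbracket t * \<bar>?F (t, x) - \<Lambda> * pd (slab \<infinity>) (0, axis 1 1) (A_hom \<A>) (t, x)\<bar> \<le> 1"
          using C\<epsilon> by linarith
      qed
      have "L1_norm (\<lambda>z. f (0, z)) * ennreal ((1 + t) powr (\<Lambda> / 40 / 5)) \<le> L1_norm (\<lambda>z. f (t, z))"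
      proof (rule L1_norm_growth[OF f F solution_transport[OF sol] force])
        fix x v assume "f (0, x, v) \<noteq> 0"
        then have "f0 (x, v) \<noteq> 0" by (simp add: data)
        then show "norm (x - vector [7, 0, 0]) \<le> 1 \<and>
            0 \<le> v $ 2 \<and> v $ 2 \<le> 1 \<and> 0 \<le> v $ 3 \<and> v $ 3 \<le> 1 \<and> 1 \<le> v $ 1"
          using f0 unfolding initial_density_def by blast
      qed (use \<Lambda> t in auto)
      then show ?thesis by (simp add: case_prod_beta')
    qed
    have "0 < \<epsilon>" "\<epsilon> \<le> \<epsilon>1" using C \<epsilon>1 by (auto simp: \<epsilon>_def)
    then show "\<exists>\<epsilon>>0. \<epsilon> \<le> \<epsilon>1 \<and>
      (\<forall>T f A. maximal_solution \<A> \<Lambda> \<epsilon> f0 T f A \<longrightarrow>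
         T < \<infinity>
       \<or> (\<forall>t\<ge>0. L1_norm (\<lambda>(x, v). f (t, x, v)) \<ge>
            L1_norm (\<lambda>(x, v). f (0, x, v)) * ennreal ((1 + t) powr (1 / 200 * \<Lambda>)))
       \<or> (\<exists>(t, x)\<in>slab T.
            jbracket t * \<bar>pd (slab T) (0, axis 1 1) A (t, x)
              - \<Lambda> * pd (slab T) (0, axis 1 1) (A_hom \<A>) (t, x)\<bar> \<ge> C * \<epsilon>))"
      using growth by blast
  qed simp
qed simp

end
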